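(* Let $\Omega\subset\mathbb{R}^d$ be a simply connected domain with Lipschitz-continuous boundary, let $f\in L^2(\Omega)$, and let $\mathbf{A}\in L_\infty(\Omega,\mathbb{R}^{d\times d})$ (not necessarily symmetric) be bounded with bounded inverse $\mathbf{A}^{-1}$ in $\Omega$, and such that there is a constant $\underline{c}>0$ with $$(\mathbf{A}\boldsymbol{\xi},\boldsymbol{\xi})_{\mathbb{R}^d}\ge \underline{c}\,\|\boldsymbol{\xi}\|_{\mathbb{R}^d}^2\quad\forall \boldsymbol{\xi}\in\mathbb{R}^d,\ \text{a.e. in }\Omega .$$ Let $C_F$ be a constant such that $\|w\|_{L^2(\Omega)}\le C_F\|\nabla w\|_{L^2(\Omega,\mathbb{R}^d)}$ for all $w\in H_0^1(\Omega)$. Let $u\in H_0^1(\Omega)$ satisfy $$(\mathbf{A}\nabla u,\nabla w)_{L^2(\Omega,\mathbb{R}^d)}=(f,w)_{L^2(\Omega)}\quad\forall w\in H_0^1(\Omega),$$ and let $v\in H_0^1(\Omega)$. Put $\mathbf{B}:=(\mathbf{I}+\mathbf{A}^T\mathbf{A}^{-1})^{-1}$. Then for every $\mathbf{y}\in H(\mathrm{div},\Omega)$, $$(\mathbf{A}\nabla(u-v),\nabla(u-v))_{L^2(\Omega,\mathbb{R}^d)}^{1/2}\le 2\,\big(\mathbf{A}^{-1}\mathbf{B}(\mathbf{y}-\mathbf{A}\nabla v),\mathbf{B}(\mathbf{y}-\mathbf{A}\nabla v)\big)_{L^2(\Omega,\mathbb{R}^d)}^{1/2}+\frac{C_F}{\sqrt{\underline{c}}}\,\|\mathrm{div}\,\mathbf{y}+f\|_{L^2(\Omega)}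 .$$
   Context: $H(\mathrm{div},\Omega)$ is the space of vector fields $\mathbf{y}\in L^2(\Omega,\mathbb{R}^d)$ whose distributional divergence $\mathrm{div}\,\mathbf{y}$ belongs to $L^2(\Omega)$. All function spaces are real. The matrix fields $\mathbf{A}^T$, $\mathbf{A}^{-1}$, $\mathbf{B}$ are defined pointwise a.e. in $\Omega$, and $\mathbf{I}$ is the identity matrix. *)

theory Defs
  imports "HOL-Analysis.Analysis"
begin

definition domain :: "('a::euclidean_space) set \<Rightarrow> bool" where
  "domain \<Omega> \<longleftrightarrow> open \<Omega> \<and> connected \<Omega> \<and> \<Omega> \<noteq> {}"

text \<open>Near each boundary point, \<open>\<Omega>\<close> is the region strictly above the graph of a Lipschitz function
  \<open>\<gamma>\<close>, where the vertical direction is a unit vector \<open>e\<close> and the horizontal hyperplane is the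
  orthogonal complement of \<open>e\<close>.  Boundedness of \<open>\<Omega>\<close> is not part of the notion.\<close>

definition lipschitz_boundary :: "('a::euclidean_space) set \<Rightarrow> bool" where
  "lipschitz_boundary \<Omega> \<longleftrightarrow>
     (\<forall>x0 \<in> frontier \<Omega>. \<exists>r>0. \<exists>e \<gamma>. \<exists>L. norm e = 1 \<and> lipschitz_on L {z. z \<bullet> e = 0} \<gamma> \<and>
        \<Omega> \<inter> ball x0 r = {x \<in> ball x0 r. x \<bullet> e > (\<gamma> (x - (x \<bullet> e) *\<^sub>R e) :: real)})"

text \<open>Elements of the Lebesgue spaces are represented by functions, identified only up to equality
  almost everywhere in \<open>\<Omega>\<close>; values outside \<open>\<Omega>\<close> are irrelevant.\<close>

definition L2 :: "('a::euclidean_space) set \<Rightarrow> ('a \<Rightarrow> 'b::euclidean_space) set" where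
  "L2 \<Omega> = {f \<in> borel_measurable (lebesgue_on \<Omega>). integrable (lebesgue_on \<Omega>) (\<lambda>x. (norm (f x))\<^sup>2)}"

definition L2_inner ::
    "('a::euclidean_space) set \<Rightarrow> ('a \<Rightarrow> 'b::euclidean_space) \<Rightarrow> ('a \<Rightarrow> 'b) \<Rightarrow> real" where
  "L2_inner \<Omega> f g = (LINT x|lebesgue_on \<Omega>. f x \<bullet> g x)"

definition L2_norm :: "('a::euclidean_space) set \<Rightarrow> ('a \<Rightarrow> 'b::euclidean_space) \<Rightarrow> real" where
  "L2_norm \<Omega> f = sqrt (L2_inner \<Omega> f f)"

definition Linfty :: "('a::euclidean_space) set \<Rightarrow> ('a \<Rightarrow> 'b::euclidean_space) set" where
  "Linfty \<Omega> = {f \<in> borel_measurable (lebesgue_on \<Omega>). \<exists>M. AE x in lebesgue_on \<Omega>. norm (f x) \<le> M}"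

fun C_k :: "nat \<Rightarrow> ('a::euclidean_space \<Rightarrow> real) \<Rightarrow> bool" where
  "C_k 0 \<phi> \<longleftrightarrow> continuous_on UNIV \<phi>"
| "C_k (Suc k) \<phi> \<longleftrightarrow>
     (\<forall>x. \<phi> differentiable (at x)) \<and> (\<forall>v. C_k k (\<lambda>x. frechet_derivative \<phi> (at x) v))"

text \<open>The space \<open>C\<^sub>c\<^sup>\<infinity>(\<Omega>)\<close>, each function being extended by zero to the whole space.\<close>

definition test_functions :: "('a::euclidean_space) set \<Rightarrow> ('a \<Rightarrow> real) set" where
  "test_functions \<Omega> =
     {\<phi>. (\<forall>k. C_k k \<phi>) \<and> compact (closure {x. \<phi> x \<noteq> 0}) \<and> closure {x. \<phi> x \<noteq> 0} \<subseteq> \<Omega>}"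

definition gradient :: "(real^'n \<Rightarrow> real) \<Rightarrow> real^'n \<Rightarrow> real^'n" where
  "gradient \<phi> x = (\<chi> i. frechet_derivative \<phi> (at x) (axis i 1))"

definition is_weak_grad ::
    "(real^'n) set \<Rightarrow> (real^'n \<Rightarrow> real) \<Rightarrow> (real^'n \<Rightarrow> real^'n) \<Rightarrow> bool" where
  "is_weak_grad \<Omega> w g \<longleftrightarrow> g \<in> L2 \<Omega> \<and>
     (\<forall>\<phi> \<in> test_functions \<Omega>. \<forall>i.
        (LINT x|lebesgue_on \<Omega>. w x * gradient \<phi> x $ i) = - (LINT x|lebesgue_on \<Omega>. g x $ i * \<phi> x))"

definition H1 :: "(real^'n) set \<Rightarrow> (real^'n \<Rightarrow> real) set" where
  "H1 \<Omega> = {w \<in> L2 \<Omega>. \<exists>g. is_weak_grad \<Omega> w g}"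

text \<open>The weak gradient is determined up to equality almost everywhere in \<open>\<Omega>\<close>; a representative is
  chosen. It is meaningful only for functions in \<open>H1 \<Omega>\<close>. The same remarks apply to \<open>weak_div\<close> and
  \<open>Hdiv \<Omega>\<close> below.\<close>

definition weak_grad :: "(real^'n) set \<Rightarrow> (real^'n \<Rightarrow> real) \<Rightarrow> real^'n \<Rightarrow> real^'n" where
  "weak_grad \<Omega> w = (SOME g. is_weak_grad \<Omega> w g)"

definition H1_norm :: "(real^'n) set \<Rightarrow> (real^'n \<Rightarrow> real) \<Rightarrow> real" where
  "H1_norm \<Omega> w = sqrt ((L2_norm \<Omega> w)\<^sup>2 + (L2_norm \<Omega> (weak_grad \<Omega> w))\<^sup>2)"

text \<open>\<open>H\<^sub>0\<^sup>1(\<Omega>)\<close> is the closure of \<open>C\<^sub>c\<^sup>\<infinity>(\<Omega>)\<close> in \<open>H\<^sup>1(\<Omega>)\<close>.\<close>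

definition H01 :: "(real^'n) set \<Rightarrow> (real^'n \<Rightarrow> real) set" where
  "H01 \<Omega> = {w \<in> H1 \<Omega>. \<exists>\<phi>. (\<forall>k::nat. \<phi> k \<in> test_functions \<Omega>) \<and>
                 (\<lambda>k. H1_norm \<Omega> (\<lambda>x. w x - \<phi> k x)) \<longlonglongrightarrow> 0}"

definition is_weak_div ::
    "(real^'n) set \<Rightarrow> (real^'n \<Rightarrow> real^'n) \<Rightarrow> (real^'n \<Rightarrow> real) \<Rightarrow> bool" where
  "is_weak_div \<Omega> y g \<longleftrightarrow> g \<in> L2 \<Omega> \<and>
     (\<forall>\<phi> \<in> test_functions \<Omega>.
        (LINT x|lebesgue_on \<Omega>. y x \<bullet> gradient \<phi> x) = - (LINT x|lebesgue_on \<Omega>. g x * \<phi> x))"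

definition Hdiv :: "(real^'n) set \<Rightarrow> (real^'n \<Rightarrow> real^'n) set" where
  "Hdiv \<Omega> = {y \<in> L2 \<Omega>. \<exists>g. is_weak_div \<Omega> y g}"

definition weak_div :: "(real^'n) set \<Rightarrow> (real^'n \<Rightarrow> real^'n) \<Rightarrow> real^'n \<Rightarrow> real" where
  "weak_div \<Omega> y = (SOME g. is_weak_div \<Omega> y g)"

end

theory Submission
  imports Defs "HOL-Computational_Algebra.Polynomial"
begin

text \<open>Write \<open>e = u - v\<close>, \<open>\<eta> = y - A\<nabla>v\<close> and \<open>S = A + A\<^sup>T\<close>. The equation for \<open>u\<close> tested with \<open>e\<close> and
  integration by parts against \<open>y\<close> give \<open>(A\<nabla>e, \<nabla>e) = (div y + f, e) + (\<eta>, \<nabla>e)\<close>. The first term is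
  bounded by the Friedrichs inequality and coercivity. For the second, \<open>B = A S\<^sup>-\<^sup>1\<close>, so that
  \<open>w = A\<^sup>-\<^sup>1 B \<eta> = S\<^sup>-\<^sup>1 \<eta>\<close> satisfies \<open>w \<bullet> B\<eta> = A w \<bullet> w\<close>; the Cauchy--Schwarz inequality for
  the form \<open>S\<close> bounds \<open>\<eta> \<bullet> \<nabla>e = S w \<bullet> \<nabla>e\<close> by \<open>2 (A w \<bullet> w)\<^sup>1\<^sup>/\<^sup>2 (A\<nabla>e \<bullet> \<nabla>e)\<^sup>1\<^sup>/\<^sup>2\<close>. The
  fundamental lemma of the calculus of variations makes weak gradients unique almost everywhere, so
  that they are linear and agree with classical gradients of test functions.\<close>

section \<open>Smooth functions\<close>

text \<open>\<open>C_k\<close> is phrased with \<open>frechet_derivative\<close>, a chosen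
  derivative. Uniqueness of derivatives allows any explicitly known one in its place.\<close>

lemma C_k_SucI:
  assumes "\<And>x. (f has_derivative f' x) (at x)" "\<And>v. C_k k (\<lambda>x. f' x v)"
  shows "C_k (Suc k) f"
proof -
  have "frechet_derivative f (at x) = f' x" for x
    using frechet_derivative_at[OF assms(1)] by simp
  then show ?thesis
    using assms by (auto simp: differentiable_def)
qed

lemma C_k_SucD:
  assumes "C_k (Suc k) f"
  shows "(f has_derivative frechet_derivative f (at x)) (at x)"
    and "C_k k (\<lambda>x. frechet_derivative f (at x) v)"
  using assms frechet_derivative_works by auto

text \<open>The product rule leaves one factor undifferentiated, so the induction for products also
  needs each factor at the lower order.\<close>

lemma C_k_decrease: "C_k (Suc k) f \<Longrightarrow> C_k k f"
proof (induction k arbitrary: f)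
  case 0
  then show ?case
    by (auto intro!: continuous_at_imp_continuous_on differentiable_imp_continuous_within)
next
  case (Suc k)
  then show ?case by (metis C_k.simps(2))
qed

lemma C_k_const: "C_k k (\<lambda>x. c)"
proof (induction k arbitrary: c)
  case (Suc k)
  then show ?case
    by (intro C_k_SucI[where f' = "\<lambda>_ _. 0"]) auto
qed auto

lemma C_k_add: "C_k k f \<Longrightarrow> C_k k g \<Longrightarrow> C_k k (\<lambda>x. f x + g x)"
proof (induction k arbitrary: f g)
  case 0
  then show ?case by (auto intro: continuous_on_add)
next
  case (Suc k)
  show ?case
    by (rule C_k_SucI[OF has_derivative_add[OF C_k_SucD(1)[OF Suc.prems(1)] C_k_SucD(1)[OF Suc.prems(2)]]])
      (intro Suc.IH C_k_SucD(2)[OF Suc.prems(1)] C_k_SucD(2)[OF Suc.prems(2)])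
qed

lemma C_k_mult: "C_k k f \<Longrightarrow> C_k k g \<Longrightarrow> C_k k (\<lambda>x. f x * g x)"
proof (induction k arbitrary: f g)
  case 0
  then show ?case by (auto intro: continuous_on_mult)
next
  case (Suc k)
  show ?case
    by (rule C_k_SucI[OF has_derivative_mult[OF C_k_SucD(1)[OF Suc.prems(1)] C_k_SucD(1)[OF Suc.prems(2)]]])
      (intro C_k_add Suc.IH C_k_SucD(2)[OF Suc.prems(1)] C_k_SucD(2)[OF Suc.prems(2)]
        C_k_decrease[OF Suc.prems(1)] C_k_decrease[OF Suc.prems(2)])
qed

lemma C_k_diff: "C_k k f \<Longrightarrow> C_k k g \<Longrightarrow> C_k k (\<lambda>x. f x - g x)"
  using C_k_add[of k f "\<lambda>x. -1 * g x"] C_k_mult[OF C_k_const[of k "-1"], of g] by simp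

lemma C_k_prod: "finite I \<Longrightarrow> (\<And>i. i \<in> I \<Longrightarrow> C_k k (f i)) \<Longrightarrow> C_k k (\<lambda>x. \<Prod>i\<in>I. f i x)"
  by (induction I rule: finite_induct) (auto intro: C_k_const C_k_mult)

text \<open>Differentiating exp (-1/t) produces polynomial factors in 1/t. Carrying an arbitrary
  polynomial closes the family under differentiation, so that smoothness is an induction on the
  order, for all \<open>p\<close> at once.\<close>

definition flat_exp :: "real poly \<Rightarrow> real \<Rightarrow> real" where
  "flat_exp p t = (if t > 0 then poly p (1 / t) * exp (- (1 / t)) else 0)"

lemma poly_exp_minus_tendsto_0: "((\<lambda>x::real. poly p x * exp (- x)) \<longlongrightarrow> 0) at_top"
proof -
  have eq: "poly p x * exp (- x) = (\<Sum>i\<le>degree p. coeff p i * (x ^ i / exp x))" for x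
    by (simp add: poly_altdef sum_distrib_right exp_minus divide_inverse mult.assoc)
  have "((\<lambda>x::real. \<Sum>i\<le>degree p. coeff p i * (x ^ i / exp x)) \<longlongrightarrow> (\<Sum>i\<le>degree p. coeff p i * 0)) at_top"
    by (intro tendsto_intros tendsto_power_div_exp_0)
  then show ?thesis
    by (simp add: eq)
qed

text \<open>With s = 1/t, the chain rule turns p(s) exp(-s) into s^2 (p(s) - p'(s)) exp(-s), which
  gives the new polynomial. At the origin exponential decay beats every power of 1/t, so the
  difference quotient tends to 0 from both sides.\<close>

lemma flat_exp_has_derivative:
  "(flat_exp p has_real_derivative flat_exp (monom 1 2 * (p - pderiv p)) t) (at t)"
proof -
  consider "t > 0" | "t < 0" | "t = 0" by linarith
  then show ?thesis
  proof cases
    case 1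
    have "((\<lambda>t. poly p (1 / t) * exp (- (1 / t))) has_real_derivative
        flat_exp (monom 1 2 * (p - pderiv p)) t) (at t)"
      using 1 by (auto intro!: derivative_eq_intros DERIV_chain'[OF _ poly_DERIV]
          simp: flat_exp_def poly_monom field_simps power2_eq_square)
    then show ?thesis
      by (rule has_field_derivative_transform_within_open[of _ _ _ "{0<..}"])
        (use 1 in \<open>auto simp: flat_exp_def\<close>)
  next
    case 2
    have "((\<lambda>t. 0) has_real_derivative flat_exp (monom 1 2 * (p - pderiv p)) t) (at t)"
      using 2 by (simp add: flat_exp_def)
    then show ?thesis
      by (rule has_field_derivative_transform_within_open[of _ _ _ "{..<0}"])
        (use 2 in \<open>auto simp: flat_exp_def\<close>)
  next
    case 3
    \<comment> \<open>\<open>pCons 0 p\<close> is X p(X): the factor \<open>1 / h\<close> of the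
      difference quotient is absorbed into the polynomial.\<close>
    have "((\<lambda>h. poly (pCons 0 p) (inverse h) * exp (- inverse h)) \<longlongrightarrow> 0) (at_right 0)"
      using filterlim_compose[OF poly_exp_minus_tendsto_0 filterlim_inverse_at_top_right] .
    then have "((\<lambda>h. flat_exp p h / h) \<longlongrightarrow> 0) (at_right 0)"
      by (rule Lim_transform_eventually)
        (auto simp: flat_exp_def field_simps intro!: eventually_mono[OF eventually_at_right_less[of 0]])
    moreover have "((\<lambda>h. flat_exp p h / h) \<longlongrightarrow> 0) (at_left 0)"
      by (rule Lim_transform_eventually[OF tendsto_const])
        (auto simp: flat_exp_def intro!: eventually_at_leftI[of "-1"])
    ultimately have "((\<lambda>h. flat_exp p h / h) \<longlongrightarrow> 0) (at 0)"
      by (simp add: filterlim_split_at)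
    then show ?thesis
      using 3 by (simp add: DERIV_def flat_exp_def)
  qed
qed

lemma C_k_flat_exp: "C_k k (\<lambda>x. flat_exp p (a + b * (x \<bullet> w)))"
proof (induction k arbitrary: p)
  case 0
  have "isCont (flat_exp p) t" for t
    using DERIV_isCont[OF flat_exp_has_derivative] .
  then have "continuous_on UNIV (flat_exp p)"
    by (simp add: continuous_at_imp_continuous_on)
  then have "continuous_on UNIV (\<lambda>x. flat_exp p (a + b * (x \<bullet> w)))"
    by (rule continuous_on_compose2) (auto intro!: continuous_intros)
  then show ?case by simp
next
  case (Suc k)
  let ?q = "monom 1 2 * (p - pderiv p)"
  have "((\<lambda>x. flat_exp p (a + b * (x \<bullet> w))) has_derivative
      (\<lambda>v. (b * (v \<bullet> w)) * flat_exp ?q (a + b * (x \<bullet> w)))) (at x)" for x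
  proof -
    have "((\<lambda>x. a + b * (x \<bullet> w)) has_derivative (\<lambda>v. b * (v \<bullet> w))) (at x)"
      by (auto intro!: derivative_eq_intros)
    from has_derivative_compose[OF this flat_exp_has_derivative[unfolded has_field_derivative_def]]
    show ?thesis by (simp add: mult.commute)
  qed
  then show ?case
    by (rule C_k_SucI) (intro C_k_mult C_k_const Suc.IH)
qed

lemma flat_exp_1_le: "0 \<le> flat_exp 1 t" "flat_exp 1 t \<le> 1"
  by (auto simp: flat_exp_def)

lemma flat_exp_1_eq_0_iff: "flat_exp 1 t = 0 \<longleftrightarrow> t \<le> 0"
  by (auto simp: flat_exp_def)

text \<open>For positive \<open>t\<close> the argument grows without bound and exp (-1/(n t)) tends
  to 1. The dilations are thus smooth approximations of the step function, from which indicators of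
  boxes are built.\<close>

lemma flat_exp_1_tendsto:
  "(\<lambda>n. flat_exp 1 (real (Suc n) * t)) \<longlonglongrightarrow> (if t > 0 then 1 else 0)"
proof (cases "t > 0")
  case True
  have "(\<lambda>n. exp (- (inverse (real (Suc n)) * inverse t))) \<longlonglongrightarrow> exp (- (0 * inverse t))"
    by (intro tendsto_intros LIMSEQ_inverse_real_of_nat)
  then show ?thesis
    using True by (simp add: flat_exp_def field_simps del: of_nat_Suc)
next
  case False
  then have "real (Suc n) * t \<le> 0" for n
    by (simp add: mult_nonneg_nonpos del: of_nat_Suc)
  then show ?thesis
    using False by (simp add: flat_exp_1_eq_0_iff[THEN iffD2])
qed

section \<open>The space of square integrable functions\<close>

text \<open>This form covers both the Cauchy-Schwarz inequality in \<open>L2\<close> and its variant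
  for the quadratic form of the coefficient matrix. It follows by integrating a weighted Young
  inequality.\<close>

lemma abs_integral_le_sqrt_mult_sqrt:
  fixes h a b :: "'a \<Rightarrow> real"
  assumes h: "integrable M h" and a: "integrable M a" and b: "integrable M b"
    and a0: "AE x in M. 0 \<le> a x" and b0: "AE x in M. 0 \<le> b x"
    and hab: "AE x in M. \<bar>h x\<bar> \<le> sqrt (a x) * sqrt (b x)"
  shows "\<bar>integral\<^sup>L M h\<bar> \<le> sqrt (integral\<^sup>L M a) * sqrt (integral\<^sup>L M b)"
proof -
  have A: "0 \<le> integral\<^sup>L M a" and B: "0 \<le> integral\<^sup>L M b"
    using a0 b0 by (auto intro: integral_nonneg_AE)
  \<comment> \<open>The degenerate cases are settled separately, because the weights below divide by
    the square roots of both integrals.\<close>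
  have null: "integral\<^sup>L M h = 0" if "AE x in M. a x = 0 \<or> b x = 0"
  proof -
    have "AE x in M. h x = 0"
      using that hab by eventually_elim auto
    then show ?thesis by (rule integral_eq_zero_AE)
  qed
  consider "integral\<^sup>L M a = 0" | "integral\<^sup>L M b = 0" | "0 < integral\<^sup>L M a" "0 < integral\<^sup>L M b"
    using A B by linarith
  then show ?thesis
  proof cases
    case 1
    then have "AE x in M. a x = 0"
      using integral_nonneg_eq_0_iff_AE[OF a a0] by simp
    then have "AE x in M. a x = 0 \<or> b x = 0"
      by (rule eventually_mono) simp
    from null[OF this] show ?thesis using A B by simp
  next
    case 2
    then have "AE x in M. b x = 0"
      using integral_nonneg_eq_0_iff_AE[OF b b0] by simp
    then have "AE x in M. a x = 0 \<or> b x = 0"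
      by (rule eventually_mono) simp
    from null[OF this] show ?thesis using A B by simp
  next
    case 3
    define p where "p = sqrt (integral\<^sup>L M a)"
    define q where "q = sqrt (integral\<^sup>L M b)"
    have pq: "0 < p" "0 < q" "integral\<^sup>L M a = p\<^sup>2" "integral\<^sup>L M b = q\<^sup>2"
      using 3 by (auto simp: p_def q_def)
    \<comment> \<open>The weights \<open>q / p\<close> and \<open>p / q\<close> are chosen so that
      both terms have the same integral \<open>p * q\<close>.\<close>
    have young: "\<bar>h x\<bar> \<le> (q / p * a x + p / q * b x) / 2"
      if "0 \<le> a x" "0 \<le> b x" "\<bar>h x\<bar> \<le> sqrt (a x) * sqrt (b x)" for x
    proof -
      have "0 \<le> (sqrt (q / p) * sqrt (a x) - sqrt (p / q) * sqrt (b x))\<^sup>2"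
        by simp
      also have "\<dots> = q / p * a x + p / q * b x - 2 * (sqrt (q / p) * sqrt (p / q)) * (sqrt (a x) * sqrt (b x))"
        using that pq by (simp add: power2_diff power_mult_distrib)
      also have "sqrt (q / p) * sqrt (p / q) = 1"
        using pq by (simp flip: real_sqrt_mult)
      finally show ?thesis using that by simp
    qed
    have "\<bar>integral\<^sup>L M h\<bar> \<le> (\<integral>x. \<bar>h x\<bar> \<partial>M)"
      by (rule integral_abs_bound)
    also have "\<dots> \<le> (\<integral>x. (q / p * a x + p / q * b x) / 2 \<partial>M)"
    proof (rule integral_mono_AE)
      show "AE x in M. \<bar>h x\<bar> \<le> (q / p * a x + p / q * b x) / 2"
        using a0 b0 hab by eventually_elim (rule young)
    qed (use h a b in auto)
    also have "\<dots> = (q / p * p\<^sup>2 + p / q * q\<^sup>2) / 2"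
      using a b pq by simp
    also have "\<dots> = p * q"
      using pq by (simp add: power2_eq_square)
    finally show ?thesis by (simp add: p_def q_def)
  qed
qed

lemma L2_measurable: "f \<in> L2 \<Omega> \<Longrightarrow> f \<in> borel_measurable (lebesgue_on \<Omega>)"
  by (simp add: L2_def)

lemma L2_integrable_norm_power2: "f \<in> L2 \<Omega> \<Longrightarrow> integrable (lebesgue_on \<Omega>) (\<lambda>x. (norm (f x))\<^sup>2)"
  by (simp add: L2_def)

lemma L2_integrable_inner:
  assumes "f \<in> L2 \<Omega>" "g \<in> L2 \<Omega>"
  shows "integrable (lebesgue_on \<Omega>) (\<lambda>x. f x \<bullet> g x)"
proof (rule Bochner_Integration.integrable_bound)
  show "integrable (lebesgue_on \<Omega>) (\<lambda>x. (norm (f x))\<^sup>2 + (norm (g x))\<^sup>2)"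
    using assms by (intro Bochner_Integration.integrable_add L2_integrable_norm_power2)
  show "(\<lambda>x. f x \<bullet> g x) \<in> borel_measurable (lebesgue_on \<Omega>)"
    using assms[THEN L2_measurable] by (rule borel_measurable_inner)
  have "\<bar>f x \<bullet> g x\<bar> \<le> (norm (f x))\<^sup>2 + (norm (g x))\<^sup>2" for x
  proof -
    have "\<bar>f x \<bullet> g x\<bar> \<le> norm (f x) * norm (g x)"
      by (rule Cauchy_Schwarz_ineq2)
    moreover have "2 * (norm (f x) * norm (g x)) \<le> (norm (f x))\<^sup>2 + (norm (g x))\<^sup>2"
      using sum_squares_bound[of "norm (f x)" "norm (g x)"] by simp
    moreover have "0 \<le> norm (f x) * norm (g x)" by simp
    ultimately show ?thesis by linarith
  qed
  then show "AE x in lebesgue_on \<Omega>. norm (f x \<bullet> g x) \<le> norm ((norm (f x))\<^sup>2 + (norm (g x))\<^sup>2)"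
    by simp
qed

lemma L2_integrable_mult:
  fixes f g :: "'a::euclidean_space \<Rightarrow> real"
  shows "f \<in> L2 \<Omega> \<Longrightarrow> g \<in> L2 \<Omega> \<Longrightarrow> integrable (lebesgue_on \<Omega>) (\<lambda>x. f x * g x)"
  using L2_integrable_inner[of f \<Omega> g] by simp

lemma L2_dominated:
  assumes g: "g \<in> L2 \<Omega>" and f: "f \<in> borel_measurable (lebesgue_on \<Omega>)"
    and le: "AE x in lebesgue_on \<Omega>. norm (f x) \<le> C * norm (g x)"
  shows "f \<in> L2 \<Omega>"
proof -
  have "integrable (lebesgue_on \<Omega>) (\<lambda>x. (norm (f x))\<^sup>2)"
  proof (rule Bochner_Integration.integrable_bound)
    show "integrable (lebesgue_on \<Omega>) (\<lambda>x. C\<^sup>2 * (norm (g x))\<^sup>2)"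
      using g by (intro integrable_mult_right L2_integrable_norm_power2)
    show "(\<lambda>x. (norm (f x))\<^sup>2) \<in> borel_measurable (lebesgue_on \<Omega>)"
      using f by measurable
    show "AE x in lebesgue_on \<Omega>. norm ((norm (f x))\<^sup>2) \<le> norm (C\<^sup>2 * (norm (g x))\<^sup>2)"
      using le
    proof eventually_elim
      case (elim x)
      then have "(norm (f x))\<^sup>2 \<le> (C * norm (g x))\<^sup>2"
        by (intro power_mono) auto
      then show ?case by (simp add: power_mult_distrib)
    qed
  qed
  then show ?thesis using f by (simp add: L2_def)
qed

lemma L2_add:
  assumes "f \<in> L2 \<Omega>" "g \<in> L2 \<Omega>"
  shows "(\<lambda>x. f x + g x) \<in> L2 \<Omega>"
proof -
  have "integrable (lebesgue_on \<Omega>) (\<lambda>x. (norm (f x))\<^sup>2 + (norm (g x))\<^sup>2 + 2 * (f x \<bullet> g x))"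
    using assms by (auto intro!: L2_integrable_norm_power2 L2_integrable_inner)
  also have "(\<lambda>x. (norm (f x))\<^sup>2 + (norm (g x))\<^sup>2 + 2 * (f x \<bullet> g x)) = (\<lambda>x. (norm (f x + g x))\<^sup>2)"
    by (auto simp: power2_norm_eq_inner algebra_simps inner_commute)
  finally show ?thesis
    using assms by (auto simp: L2_def)
qed

lemma L2_uminus: "f \<in> L2 \<Omega> \<Longrightarrow> (\<lambda>x. - f x) \<in> L2 \<Omega>"
  by (simp add: L2_def)

lemma L2_diff: "f \<in> L2 \<Omega> \<Longrightarrow> g \<in> L2 \<Omega> \<Longrightarrow> (\<lambda>x. f x - g x) \<in> L2 \<Omega>"
  using L2_add[OF _ L2_uminus, of f \<Omega> g] by simp

section \<open>Vector fields and matrix fields: measurability and square integrability\<close>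

lemma borel_measurable_vec_nth:
  fixes f :: "'a \<Rightarrow> 'b::euclidean_space ^ 'n"
  shows "f \<in> borel_measurable M \<Longrightarrow> (\<lambda>x. f x $ i) \<in> borel_measurable M"
  by (rule measurable_compose[of f M borel]) (auto intro!: borel_measurable_continuous_onI continuous_intros)

lemma borel_measurable_vec_lambda:
  fixes f :: "'n::finite \<Rightarrow> 'a \<Rightarrow> 'b::euclidean_space"
  assumes "\<And>i. f i \<in> borel_measurable M"
  shows "(\<lambda>x. \<chi> i. f i x) \<in> borel_measurable M"
proof (subst borel_measurable_euclidean_space, rule ballI)
  fix b :: "'b ^ 'n"
  assume "b \<in> Basis"
  then obtain i u where "b = axis i u"
    by (auto simp: Basis_vec_def)
  then show "(\<lambda>x. (\<chi> i. f i x) \<bullet> b) \<in> borel_measurable M"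
    using assms[of i] by (simp add: inner_axis borel_measurable_inner)
qed

lemma borel_measurable_matrix_vector_mult:
  fixes A :: "'a \<Rightarrow> real^'n^'m"
  assumes "A \<in> borel_measurable M" "f \<in> borel_measurable M"
  shows "(\<lambda>x. A x *v f x) \<in> borel_measurable M"
  unfolding matrix_vector_mult_def using assms
  by (intro borel_measurable_vec_lambda borel_measurable_sum borel_measurable_times borel_measurable_vec_nth)

lemma L2_component:
  assumes f: "f \<in> L2 \<Omega>"
  shows "(\<lambda>x. f x $ i) \<in> L2 \<Omega>"
proof (rule L2_dominated[OF f])
  show "(\<lambda>x. f x $ i) \<in> borel_measurable (lebesgue_on \<Omega>)"
    using f by (intro borel_measurable_vec_nth L2_measurable)
  show "AE x in lebesgue_on \<Omega>. norm (f x $ i) \<le> 1 * norm (f x)"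
    by (simp add: Finite_Cartesian_Product.norm_nth_le)
qed

text \<open>A bilinear map between finite-dimensional spaces is bounded. The size of
  \<open>K\<close> is immaterial, as it only enters a domination constant.\<close>

lemma matrix_vector_mult_norm_bound:
  "\<exists>K>0. \<forall>(A::real^'n^'m) x. norm (A *v x) \<le> norm A * norm x * K"
proof -
  have "bounded_bilinear (\<lambda>(A::real^'n^'m) x. A *v x)"
    unfolding bilinear_conv_bounded_bilinear[symmetric] bilinear_def
    by (auto intro!: linearI simp: algebra_simps scaleR_matrix_vector_assoc)
  from bounded_bilinear.pos_bounded[OF this] show ?thesis by blast
qed

lemma L2_matrix_vector_mult:
  fixes A :: "'a::euclidean_space \<Rightarrow> real^'n^'m"
  assumes A: "A \<in> Linfty \<Omega>" and f: "f \<in> L2 \<Omega>"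
  shows "(\<lambda>x. A x *v f x) \<in> L2 \<Omega>"
proof -
  obtain K where K: "K > 0" "\<And>(A::real^'n^'m) x. norm (A *v x) \<le> norm A * norm x * K"
    using matrix_vector_mult_norm_bound by metis
  obtain C where C: "AE x in lebesgue_on \<Omega>. norm (A x) \<le> C"
    using A by (auto simp: Linfty_def)
  have "norm (A x *v f x) \<le> (C * K) * norm (f x)" if "norm (A x) \<le> C" for x
  proof -
    have "norm (A x *v f x) \<le> norm (A x) * (norm (f x) * K)"
      using K(2)[of "A x" "f x"] by (simp add: mult.assoc)
    also have "\<dots> \<le> C * (norm (f x) * K)"
      using that K by (intro mult_right_mono) auto
    finally show ?thesis by (simp add: mult_ac)
  qed
  with C have "AE x in lebesgue_on \<Omega>. norm (A x *v f x) \<le> (C * K) * norm (f x)"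
    by (rule eventually_mono)
  moreover have "(\<lambda>x. A x *v f x) \<in> borel_measurable (lebesgue_on \<Omega>)"
    using A f by (intro borel_measurable_matrix_vector_mult) (auto simp: Linfty_def L2_def)
  ultimately show ?thesis
    using L2_dominated[OF f] by blast
qed

lemma L2_inner_add_left:
  "f \<in> L2 \<Omega> \<Longrightarrow> g \<in> L2 \<Omega> \<Longrightarrow> h \<in> L2 \<Omega> \<Longrightarrow>
    L2_inner \<Omega> (\<lambda>x. f x + g x) h = L2_inner \<Omega> f h + L2_inner \<Omega> g h"
  unfolding L2_inner_def inner_add_left
  by (intro Bochner_Integration.integral_add L2_integrable_inner)

lemma L2_inner_diff_left:
  "f \<in> L2 \<Omega> \<Longrightarrow> g \<in> L2 \<Omega> \<Longrightarrow> h \<in> L2 \<Omega> \<Longrightarrow>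
    L2_inner \<Omega> (\<lambda>x. f x - g x) h = L2_inner \<Omega> f h - L2_inner \<Omega> g h"
  unfolding L2_inner_def inner_diff_left
  by (intro Bochner_Integration.integral_diff L2_integrable_inner)

lemma L2_inner_diff_right:
  "f \<in> L2 \<Omega> \<Longrightarrow> g \<in> L2 \<Omega> \<Longrightarrow> h \<in> L2 \<Omega> \<Longrightarrow>
    L2_inner \<Omega> h (\<lambda>x. f x - g x) = L2_inner \<Omega> h f - L2_inner \<Omega> h g"
  unfolding L2_inner_def inner_diff_right
  by (intro Bochner_Integration.integral_diff L2_integrable_inner)

lemma L2_inner_cong_AE:
  assumes "f \<in> borel_measurable (lebesgue_on \<Omega>)" "f' \<in> borel_measurable (lebesgue_on \<Omega>)"
    "g \<in> borel_measurable (lebesgue_on \<Omega>)" "g' \<in> borel_measurable (lebesgue_on \<Omega>)"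
    "AE x in lebesgue_on \<Omega>. f x = f' x" "AE x in lebesgue_on \<Omega>. g x = g' x"
  shows "L2_inner \<Omega> f g = L2_inner \<Omega> f' g'"
  unfolding L2_inner_def
proof (rule integral_cong_AE)
  show "AE x in lebesgue_on \<Omega>. f x \<bullet> g x = f' x \<bullet> g' x"
    using assms(5,6) by eventually_elim simp
qed (use assms in auto)

lemma L2_norm_nonneg: "0 \<le> L2_norm \<Omega> f"
  by (simp add: L2_norm_def L2_inner_def)

lemma L2_norm_power2: "(L2_norm \<Omega> f)\<^sup>2 = (LINT x|lebesgue_on \<Omega>. (norm (f x))\<^sup>2)"
  by (simp add: L2_norm_def L2_inner_def power2_norm_eq_inner)

lemma abs_L2_inner_le:
  assumes "f \<in> L2 \<Omega>" "g \<in> L2 \<Omega>"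
  shows "\<bar>L2_inner \<Omega> f g\<bar> \<le> L2_norm \<Omega> f * L2_norm \<Omega> g"
  unfolding L2_norm_def L2_inner_def
proof (rule abs_integral_le_sqrt_mult_sqrt)
  show "AE x in lebesgue_on \<Omega>. \<bar>f x \<bullet> g x\<bar> \<le> sqrt (f x \<bullet> f x) * sqrt (g x \<bullet> g x)"
    using Cauchy_Schwarz_ineq2[of "f x" "g x" for x] by (simp add: norm_eq_sqrt_inner)
qed (use assms in \<open>auto intro: L2_integrable_inner\<close>)

text \<open>A consequence of the parallelogram law. It replaces the triangle inequality, and the
  factor 2 is harmless when both right-hand terms tend to 0.\<close>

lemma L2_norm_diff_power2_le:
  assumes "f \<in> L2 \<Omega>" "g \<in> L2 \<Omega>"
  shows "(L2_norm \<Omega> (\<lambda>x. f x - g x))\<^sup>2 \<le> 2 * (L2_norm \<Omega> f)\<^sup>2 + 2 * (L2_norm \<Omega> g)\<^sup>2"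
proof -
  have le: "(norm (f x - g x))\<^sup>2 \<le> 2 * (norm (f x))\<^sup>2 + 2 * (norm (g x))\<^sup>2" for x
  proof -
    have "(norm (f x - g x))\<^sup>2 + (norm (f x + g x))\<^sup>2 = 2 * (norm (f x))\<^sup>2 + 2 * (norm (g x))\<^sup>2"
      by (simp add: power2_norm_eq_inner algebra_simps inner_commute)
    moreover have "0 \<le> (norm (f x + g x))\<^sup>2" by simp
    ultimately show ?thesis by linarith
  qed
  have "(LINT x|lebesgue_on \<Omega>. (norm (f x - g x))\<^sup>2)
      \<le> (LINT x|lebesgue_on \<Omega>. 2 * (norm (f x))\<^sup>2 + 2 * (norm (g x))\<^sup>2)"
    using assms le
    by (intro integral_mono Bochner_Integration.integrable_add integrable_mult_right
        L2_integrable_norm_power2 L2_diff) auto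
  then show ?thesis
    using assms by (simp add: L2_norm_power2 L2_integrable_norm_power2)
qed

section \<open>Test functions\<close>

lemma test_functionsI:
  assumes "\<And>k. C_k k \<phi>" "compact K" "K \<subseteq> \<Omega>" "\<And>x. x \<notin> K \<Longrightarrow> \<phi> x = 0"
  shows "\<phi> \<in> test_functions \<Omega>"
proof -
  have sub: "closure {x. \<phi> x \<noteq> 0} \<subseteq> K"
    using assms(2,4) by (intro closure_minimal compact_imp_closed) auto
  moreover have "compact (closure {x. \<phi> x \<noteq> 0})"
    using compact_Int_closed[OF assms(2) closed_closure[of "{x. \<phi> x \<noteq> 0}"]] sub
    by (simp add: Int_absorb1)
  ultimately show ?thesis
    using assms(1,3) by (auto simp: test_functions_def)
qed

lemma test_functions_C_k: "\<phi> \<in> test_functions \<Omega> \<Longrightarrow> C_k k \<phi>"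
  by (simp add: test_functions_def)

lemma test_functions_continuous: "\<phi> \<in> test_functions \<Omega> \<Longrightarrow> continuous_on UNIV \<phi>"
  using test_functions_C_k[of \<phi> \<Omega> 0] by simp

lemma test_functions_has_derivative:
  "\<phi> \<in> test_functions \<Omega> \<Longrightarrow> (\<phi> has_derivative frechet_derivative \<phi> (at x)) (at x)"
  using C_k_SucD(1)[OF test_functions_C_k[of \<phi> \<Omega> "Suc 0"]] .

lemma test_functions_support:
  assumes "\<phi> \<in> test_functions \<Omega>"
  obtains K where "compact K" "K \<subseteq> \<Omega>" "\<And>x. x \<notin> K \<Longrightarrow> \<phi> x = 0"
proof
  show "compact (closure {x. \<phi> x \<noteq> 0})" "closure {x. \<phi> x \<noteq> 0} \<subseteq> \<Omega>"
    using assms by (auto simp: test_functions_def)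
  show "\<phi> x = 0" if "x \<notin> closure {x. \<phi> x \<noteq> 0}" for x
    using that closure_subset[of "{x. \<phi> x \<noteq> 0}"] by auto
qed

lemma test_functions_diff:
  assumes "\<phi> \<in> test_functions \<Omega>" "\<psi> \<in> test_functions \<Omega>"
  shows "(\<lambda>x. \<phi> x - \<psi> x) \<in> test_functions \<Omega>"
proof -
  obtain K where K: "compact K" "K \<subseteq> \<Omega>" "\<And>x. x \<notin> K \<Longrightarrow> \<phi> x = 0"
    using test_functions_support[OF assms(1)] by blast
  obtain L where L: "compact L" "L \<subseteq> \<Omega>" "\<And>x. x \<notin> L \<Longrightarrow> \<psi> x = 0"
    using test_functions_support[OF assms(2)] by blast
  show ?thesis
    by (rule test_functionsI[of _ "K \<union> L"])
      (use K L assms in \<open>auto intro: C_k_diff test_functions_C_k compact_Un\<close>)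
qed

lemma test_functions_mult:
  assumes "\<phi> \<in> test_functions \<Omega>" "\<And>k. C_k k \<psi>"
  shows "(\<lambda>x. \<phi> x * \<psi> x) \<in> test_functions \<Omega>"
proof -
  obtain K where K: "compact K" "K \<subseteq> \<Omega>" "\<And>x. x \<notin> K \<Longrightarrow> \<phi> x = 0"
    using test_functions_support[OF assms(1)] by blast
  show ?thesis
    by (rule test_functionsI[of _ K])
      (use K assms in \<open>auto intro: C_k_mult test_functions_C_k\<close>)
qed

lemma test_functions_frechet_derivative:
  assumes "\<phi> \<in> test_functions \<Omega>"
  shows "(\<lambda>x. frechet_derivative \<phi> (at x) v) \<in> test_functions \<Omega>"
proof -
  obtain K where K: "compact K" "K \<subseteq> \<Omega>" "\<And>x. x \<notin> K \<Longrightarrow> \<phi> x = 0"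
    using test_functions_support[OF assms] by blast
  show ?thesis
  proof (rule test_functionsI[OF _ K(1,2)])
    show "C_k k (\<lambda>x. frechet_derivative \<phi> (at x) v)" for k
      using C_k_SucD(2)[OF test_functions_C_k[OF assms, of "Suc k"]] .
    show "frechet_derivative \<phi> (at x) v = 0" if "x \<notin> K" for x
    proof -
      \<comment> \<open>The complement of the compact set \<open>K\<close> is open, so the function
        vanishes on a neighbourhood of \<open>x\<close>.\<close>
      have "(\<phi> has_derivative (\<lambda>_. 0)) (at x)"
        by (rule has_derivative_transform_within_open[OF has_derivative_const, of "- K" x 0])
          (use that K in \<open>auto simp: compact_imp_closed open_Compl\<close>)
      then show ?thesis
        by (simp add: frechet_derivative_at[symmetric])
    qed
  qed
qed

lemma test_functions_measurable:
  assumes "\<phi> \<in> test_functions \<Omega>"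
  shows "\<phi> \<in> borel_measurable borel" "\<phi> \<in> borel_measurable (lebesgue_on \<Omega>)"
proof -
  show *: "\<phi> \<in> borel_measurable borel"
    using test_functions_continuous[OF assms] by (rule borel_measurable_continuous_onI)
  have "\<phi> \<in> borel_measurable lebesgue"
    using * by (intro measurable_completion) simp
  then show "\<phi> \<in> borel_measurable (lebesgue_on \<Omega>)"
    by (rule measurable_restrict_space1)
qed

lemma test_functions_integrable_lborel:
  assumes "\<phi> \<in> test_functions \<Omega>"
  shows "integrable lborel \<phi>"
proof -
  obtain K where K: "compact K" "K \<subseteq> \<Omega>" "\<And>x. x \<notin> K \<Longrightarrow> \<phi> x = 0"
    using test_functions_support[OF assms] by blast
  have "integrable lborel (\<lambda>x. indicator K x *\<^sub>R \<phi> x)"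
    using K(1) continuous_on_subset[OF test_functions_continuous[OF assms]]
    by (intro borel_integrable_compact) auto
  also have "(\<lambda>x. indicator K x *\<^sub>R \<phi> x) = \<phi>"
    using K(3) by (auto simp: fun_eq_iff indicator_def)
  finally show ?thesis .
qed

text \<open>Test functions vanish outside \<Omega>, so their integrals can be moved to the whole
  space, where translation invariance is available.\<close>

lemma test_functions_integral:
  assumes "open \<Omega>" and \<phi>: "\<phi> \<in> test_functions \<Omega>"
  shows "integrable (lebesgue_on \<Omega>) \<phi>"
    and "(LINT x|lebesgue_on \<Omega>. \<phi> x) = (LINT x|lborel. \<phi> x)"
proof -
  have S: "\<Omega> \<inter> space lebesgue \<in> sets lebesgue"
    using \<open>open \<Omega>\<close> by simp
  have m: "\<phi> \<in> lborel \<rightarrow>\<^sub>M borel"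
    using test_functions_measurable(1)[OF \<phi>] by simp
  obtain K where K: "compact K" "K \<subseteq> \<Omega>" "\<And>x. x \<notin> K \<Longrightarrow> \<phi> x = 0"
    using test_functions_support[OF \<phi>] by blast
  have "indicator \<Omega> x *\<^sub>R \<phi> x = \<phi> x" for x
    using K(2) K(3)[of x] by (cases "x \<in> \<Omega>") auto
  then have eq: "(\<lambda>x. indicator \<Omega> x *\<^sub>R \<phi> x) = \<phi>"
    by (rule ext)
  show "integrable (lebesgue_on \<Omega>) \<phi>"
    using test_functions_integrable_lborel[OF \<phi>] integrable_completion[OF m]
    unfolding integrable_restrict_space[OF S] eq by simp
  show "(LINT x|lebesgue_on \<Omega>. \<phi> x) = (LINT x|lborel. \<phi> x)"
    unfolding integral_restrict_space[OF S] eq by (rule integral_completion[OF m])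
qed

lemma test_functions_L2:
  assumes "open \<Omega>" "\<phi> \<in> test_functions \<Omega>"
  shows "\<phi> \<in> L2 \<Omega>"
proof -
  have "integrable (lebesgue_on \<Omega>) (\<lambda>x. \<phi> x * \<phi> x)"
    using assms by (intro test_functions_integral(1) test_functions_mult test_functions_C_k)
  then show ?thesis
    using test_functions_measurable(2)[OF assms(2)] by (simp add: L2_def power2_eq_square)
qed

text \<open>Translation invariance: the difference quotients of \<open>\<phi>\<close> integrate to zero and converge
  boundedly to the directional derivative.\<close>

lemma integral_frechet_derivative_test_function:
  assumes \<phi>: "\<phi> \<in> test_functions \<Omega>"
  shows "(LINT x|lborel. frechet_derivative \<phi> (at x) v) = 0"
proof -
  define \<psi> where "\<psi> x = frechet_derivative \<phi> (at x) v" for x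
  have \<psi>: "\<psi> \<in> test_functions \<Omega>"
    using test_functions_frechet_derivative[OF \<phi>] by (simp add: \<psi>_def[abs_def])
  obtain K where K: "compact K" "K \<subseteq> \<Omega>" "\<And>x. x \<notin> K \<Longrightarrow> \<phi> x = 0"
    using test_functions_support[OF \<phi>] by blast
  obtain L where L: "compact L" "L \<subseteq> \<Omega>" "\<And>x. x \<notin> L \<Longrightarrow> \<psi> x = 0"
    using test_functions_support[OF \<psi>] by blast
  have "bounded (\<psi> ` L)"
    using L(1) continuous_on_subset[OF test_functions_continuous[OF \<psi>], of L]
    by (intro compact_imp_bounded compact_continuous_image) auto
  then obtain M where M: "M > 0" "\<And>x. x \<in> L \<Longrightarrow> \<bar>\<psi> x\<bar> \<le> M"
    unfolding bounded_pos by auto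
  have M': "\<bar>\<psi> x\<bar> \<le> M" for x
    using M L(3)[of x] by (cases "x \<in> L") auto
  obtain R where R: "\<And>x. x \<in> K \<Longrightarrow> norm x \<le> R"
    using compact_imp_bounded[OF K(1)] unfolding bounded_iff by auto
  have deriv: "((\<lambda>t. \<phi> (x + t *\<^sub>R v)) has_real_derivative \<psi> (x + t *\<^sub>R v)) (at t)" for x t
  proof -
    have 1: "((\<lambda>t. x + t *\<^sub>R v) has_derivative (\<lambda>t. t *\<^sub>R v)) (at t)"
      by (auto intro!: derivative_eq_intros)
    have 2: "frechet_derivative \<phi> (at y) (s *\<^sub>R v) = s * \<psi> y" for s y
      using linear_frechet_derivative[OF differentiableI[OF test_functions_has_derivative[OF \<phi>]]]
      by (simp add: \<psi>_def linear_cmul)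
    from has_derivative_compose[OF 1 test_functions_has_derivative[OF \<phi>]]
    show ?thesis
      by (simp add: 2 has_field_derivative_def mult_commute_abs)
  qed
  define h :: "nat \<Rightarrow> real" where "h n = inverse (real (Suc n))" for n
  have h: "0 < h n" "h n \<le> 1" for n
    by (auto simp: h_def field_simps)
  have h0: "h \<longlonglongrightarrow> 0"
    unfolding h_def[abs_def] by (rule LIMSEQ_inverse_real_of_nat)
  define q where "q n x = (\<phi> (x + h n *\<^sub>R v) - \<phi> x) / h n" for n x
  have [measurable]: "\<phi> \<in> borel_measurable borel" "\<psi> \<in> borel_measurable borel"
    by (intro test_functions_measurable(1)[OF \<phi>] test_functions_measurable(1)[OF \<psi>])+
  have shift: "(\<lambda>x. \<phi> (x + c)) \<in> borel_measurable borel" for c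
    by measurable
  have int_q: "(LINT x|lborel. q n x) = 0" for n
  proof -
    have d: "distr lborel borel ((+) (h n *\<^sub>R v)) = lborel"
      by (rule lborel_distr_plus)
    have eq: "(LINT x|lborel. \<phi> x) = (LINT x|lborel. \<phi> (h n *\<^sub>R v + x))"
      using integral_distr[of "(+) (h n *\<^sub>R v)" lborel borel \<phi>] unfolding d by simp
    have i1: "integrable lborel \<phi>"
      using test_functions_integrable_lborel[OF \<phi>] .
    have i2: "integrable lborel (\<lambda>x. \<phi> (h n *\<^sub>R v + x))"
      using integrable_distr[of "(+) (h n *\<^sub>R v)" lborel borel \<phi>] i1 unfolding d by simp
    show ?thesis
      using i1 i2 eq by (simp add: q_def add.commute)
  qed
  \<comment> \<open>The integrable majorant: the mean value inequality bounds the quotients by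
    \<open>M\<close>. Since \<open>h n \<le> 1\<close>, a point outside the ball of radius
    \<open>R + norm v\<close> and its translate both avoid \<open>K\<close>, so there the quotient
    is 0.\<close>
  have bound: "\<bar>q n x\<bar> \<le> M * indicator (cball 0 (R + norm v)) x" for n x
  proof (cases "x \<in> cball 0 (R + norm v)")
    case True
    have "norm (\<phi> (x + h n *\<^sub>R v) - \<phi> (x + 0 *\<^sub>R v)) \<le> M * norm (h n - 0)"
      by (rule field_differentiable_bound[of UNIV _ "\<lambda>t. \<psi> (x + t *\<^sub>R v)"])
        (use deriv M' in auto)
    then show ?thesis
      using True h[of n] by (simp add: q_def field_simps)
  next
    case False
    have "norm (h n *\<^sub>R v) \<le> norm v"
      using h[of n] by (simp add: mult_left_le_one_le)
    then have "norm x \<le> norm (x + h n *\<^sub>R v) + norm v"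
      using norm_triangle_ineq4[of "x + h n *\<^sub>R v" "h n *\<^sub>R v"] by simp
    then have "x \<notin> K" "x + h n *\<^sub>R v \<notin> K"
      using False R[of x] R[of "x + h n *\<^sub>R v"] norm_ge_zero[of v] by (auto simp del: norm_ge_zero)
    then show ?thesis
      using False K(3) by (simp add: q_def)
  qed
  have lim: "(\<lambda>n. q n x) \<longlonglongrightarrow> \<psi> x" for x
  proof -
    have "((\<lambda>t. (\<phi> (x + t *\<^sub>R v) - \<phi> x) / t) \<longlongrightarrow> \<psi> x) (at 0)"
      using deriv[of x 0] by (simp add: DERIV_def)
    moreover have "filterlim h (at 0) sequentially"
      using h0 h(1) by (auto simp: filterlim_at less_imp_neq[symmetric] intro!: always_eventually)
    ultimately show ?thesis
      unfolding q_def by (rule filterlim_compose)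
  qed
  have "(\<lambda>n. LINT x|lborel. q n x) \<longlonglongrightarrow> (LINT x|lborel. \<psi> x)"
  proof (rule integral_dominated_convergence)
    show "integrable lborel (\<lambda>x. M * indicator (cball 0 (R + norm v)) x)"
      using emeasure_lborel_cball_finite
      by (intro integrable_mult_right) (auto simp: integrable_indicator_iff)
    show "q n \<in> borel_measurable lborel" for n
      unfolding q_def[abs_def] using shift[of "h n *\<^sub>R v"] by measurable
  qed (use bound lim in \<open>auto intro!: always_eventually\<close>)
  then have "(LINT x|lborel. \<psi> x) = 0"
    unfolding int_q by (simp add: LIMSEQ_const_iff)
  then show ?thesis by (simp add: \<psi>_def)
qed

lemma L2_vec_lambda:
  fixes f :: "'n::finite \<Rightarrow> 'a::euclidean_space \<Rightarrow> real"
  assumes "\<And>i. f i \<in> L2 \<Omega>"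
  shows "(\<lambda>x. \<chi> i. f i x) \<in> L2 \<Omega>"
proof -
  have eq: "(norm (\<chi> i. f i x))\<^sup>2 = (\<Sum>i\<in>UNIV. (norm (f i x))\<^sup>2)" for x
    by (simp add: norm_vec_def L2_set_def sum_nonneg)
  have "integrable (lebesgue_on \<Omega>) (\<lambda>x. (norm (\<chi> i. f i x))\<^sup>2)"
    unfolding eq by (intro Bochner_Integration.integrable_sum L2_integrable_norm_power2 assms)
  moreover have "(\<lambda>x. \<chi> i. f i x) \<in> borel_measurable (lebesgue_on \<Omega>)"
    by (intro borel_measurable_vec_lambda L2_measurable assms)
  ultimately show ?thesis by (simp add: L2_def)
qed

lemma test_functions_gradient_component:
  "\<phi> \<in> test_functions \<Omega> \<Longrightarrow> (\<lambda>x. gradient \<phi> x $ i) \<in> test_functions \<Omega>"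
  by (simp add: gradient_def test_functions_frechet_derivative)

lemma gradient_L2:
  assumes "open \<Omega>" "\<phi> \<in> test_functions \<Omega>"
  shows "gradient \<phi> \<in> L2 \<Omega>"
proof -
  have "(\<lambda>x. \<chi> i. gradient \<phi> x $ i) \<in> L2 \<Omega>"
    by (intro L2_vec_lambda test_functions_L2 test_functions_gradient_component assms)
  then show ?thesis by simp
qed

text \<open>The product of two test functions is a test function, so the integral of its partial
  derivative vanishes. Expanding by the product rule gives the integration by parts formula.\<close>

lemma is_weak_grad_gradient:
  assumes \<Omega>: "open \<Omega>" and \<phi>: "\<phi> \<in> test_functions \<Omega>"
  shows "is_weak_grad \<Omega> \<phi> (gradient \<phi>)"
  unfolding is_weak_grad_def
proof (intro conjI ballI allI)
  show "gradient \<phi> \<in> L2 \<Omega>"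
    using assms by (rule gradient_L2)
  fix \<psi> i
  assume \<psi>: "\<psi> \<in> test_functions \<Omega>"
  have eq: "frechet_derivative (\<lambda>x. \<phi> x * \<psi> x) (at x) (axis i 1) =
      \<phi> x * gradient \<psi> x $ i + gradient \<phi> x $ i * \<psi> x" for x
    using frechet_derivative_at[OF has_derivative_mult[OF test_functions_has_derivative[OF \<phi>]
          test_functions_has_derivative[OF \<psi>], of x], symmetric]
    by (simp add: gradient_def)
  have prod: "(\<lambda>x. \<phi> x * \<psi> x) \<in> test_functions \<Omega>"
    using \<phi> test_functions_C_k[OF \<psi>] by (rule test_functions_mult)
  have "(LINT x|lebesgue_on \<Omega>. \<phi> x * gradient \<psi> x $ i + gradient \<phi> x $ i * \<psi> x) = 0"
    using test_functions_integral(2)[OF \<Omega> test_functions_frechet_derivative[OF prod, of "axis i 1"]]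
      integral_frechet_derivative_test_function[OF prod, of "axis i 1"]
    by (simp add: eq)
  moreover have "integrable (lebesgue_on \<Omega>) (\<lambda>x. \<phi> x * gradient \<psi> x $ i)"
    "integrable (lebesgue_on \<Omega>) (\<lambda>x. gradient \<phi> x $ i * \<psi> x)"
    using \<Omega> \<phi> \<psi> by (auto intro!: L2_integrable_mult test_functions_L2 test_functions_gradient_component)
  ultimately show "(LINT x|lebesgue_on \<Omega>. \<phi> x * gradient \<psi> x $ i) =
      - (LINT x|lebesgue_on \<Omega>. gradient \<phi> x $ i * \<psi> x)"
    by (simp add: eq_neg_iff_add_eq_0)
qed

section \<open>The fundamental lemma of the calculus of variations\<close>

text \<open>A smooth function that is positive exactly on the open box: each coordinate contributes
  one factor for the lower face and one for the upper face. Larger \<open>n\<close> steepens the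
  transition at the faces.\<close>

definition box_bump :: "'a::euclidean_space \<Rightarrow> 'a \<Rightarrow> nat \<Rightarrow> 'a \<Rightarrow> real" where
  "box_bump a b n x = (\<Prod>i\<in>Basis. flat_exp 1 (real (Suc n) * (x \<bullet> i - a \<bullet> i)) *
     flat_exp 1 (real (Suc n) * (b \<bullet> i - x \<bullet> i)))"

lemma box_bump_eq_0: "x \<notin> box a b \<Longrightarrow> box_bump a b n x = 0"
  by (auto simp: box_bump_def mem_box flat_exp_1_eq_0_iff not_less mult_le_0_iff intro!: prod_zero)

lemma box_bump_bounds: "0 \<le> box_bump a b n x" "box_bump a b n x \<le> 1"
proof -
  have "0 \<le> flat_exp 1 s * flat_exp 1 t \<and> flat_exp 1 s * flat_exp 1 t \<le> 1" for s t
    using flat_exp_1_le[of s] flat_exp_1_le[of t] by (simp add: mult_le_one)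
  then show "0 \<le> box_bump a b n x" "box_bump a b n x \<le> 1"
    unfolding box_bump_def by (auto intro!: prod_nonneg prod_le_1)
qed

lemma box_bump_test_function:
  assumes "cbox a b \<subseteq> \<Omega>"
  shows "box_bump a b n \<in> test_functions \<Omega>"
proof (rule test_functionsI[OF _ compact_cbox assms])
  show "box_bump a b n x = 0" if "x \<notin> cbox a b" for x
    using that box_subset_cbox[of a b] by (intro box_bump_eq_0) auto
  fix k
  have "C_k k (\<lambda>x::'a. flat_exp 1 (real (Suc n) * (x \<bullet> i - a \<bullet> i)))" for i
    using C_k_flat_exp[of k 1 "- (real (Suc n) * (a \<bullet> i))" "real (Suc n)" i]
    by (simp add: right_diff_distrib)
  moreover have "C_k k (\<lambda>x::'a. flat_exp 1 (real (Suc n) * (b \<bullet> i - x \<bullet> i)))" for i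
    using C_k_flat_exp[of k 1 "real (Suc n) * (b \<bullet> i)" "- real (Suc n)" i]
    by (simp only: right_diff_distrib mult_minus_left add_uminus_conv_diff)
  ultimately show "C_k k (box_bump a b n)"
    unfolding box_bump_def[abs_def] by (intro C_k_prod C_k_mult) auto
qed

lemma box_bump_tendsto: "(\<lambda>n. box_bump a b n x) \<longlonglongrightarrow> indicator (box a b) x"
proof (cases "x \<in> box a b")
  case True
  have "(\<lambda>n. box_bump a b n x) \<longlonglongrightarrow> (\<Prod>i\<in>(Basis::'a set). (if x \<bullet> i - a \<bullet> i > 0 then 1 else 0) *
      (if b \<bullet> i - x \<bullet> i > 0 then 1 else 0))"
    unfolding box_bump_def by (intro tendsto_prod tendsto_mult flat_exp_1_tendsto)
  also have "(\<Prod>i\<in>(Basis::'a set). (if x \<bullet> i - a \<bullet> i > 0 then 1 else 0) *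
      (if b \<bullet> i - x \<bullet> i > 0 then 1 else 0)) = (1::real)"
    using True by (intro prod.neutral) (auto simp: mem_box)
  finally show ?thesis using True by simp
next
  case False
  then show ?thesis by (simp add: box_bump_eq_0)
qed

lemma indicator_L2:
  assumes "S \<in> sets (lebesgue_on \<Omega>)" "emeasure (lebesgue_on \<Omega>) S < \<infinity>"
  shows "indicat_real S \<in> L2 \<Omega>"
proof -
  have m: "indicat_real S \<in> borel_measurable (lebesgue_on \<Omega>)"
    using assms(1) by (rule borel_measurable_indicator)
  have "integrable (lebesgue_on \<Omega>) (\<lambda>x. (norm (indicat_real S x))\<^sup>2)"
  proof (rule integrableI_bounded_set[OF assms(1) _ assms(2), where B = 1])
    show "(\<lambda>x. (norm (indicat_real S x))\<^sup>2) \<in> borel_measurable (lebesgue_on \<Omega>)"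
      using m by measurable
  qed (auto simp: indicator_def)
  then show ?thesis
    using m by (simp add: L2_def)
qed

lemma indicator_cbox_L2: "indicat_real (cbox a b) \<in> L2 UNIV"
  using lmeasurable_cbox[of a b] by (intro indicator_L2) (auto simp: lebesgue_on_UNIV_eq fmeasurable_def)

text \<open>The box bumps turn the hypothesis into \<open>\<integral>\<^bsub>Q\<^esub> g = 0\<close> for every box \<open>Q \<subseteq> \<Omega>\<close>, and Lebesgue's
  differentiation theorem recovers \<open>g\<close> from its averages over small cubes.\<close>

lemma L2_orthogonal_test_functions_imp_0:
  fixes g :: "'a::euclidean_space \<Rightarrow> real"
  assumes \<Omega>: "open \<Omega>" and g: "g \<in> L2 \<Omega>"
    and orth: "\<And>\<phi>. \<phi> \<in> test_functions \<Omega> \<Longrightarrow> (LINT x|lebesgue_on \<Omega>. g x * \<phi> x) = 0"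
  shows "AE x in lebesgue_on \<Omega>. g x = 0"
proof -
  have S: "\<Omega> \<in> sets lebesgue"
    using \<Omega> by simp
  \<comment> \<open>Extension by zero allows the differentiation theorem, stated for functions on
    the whole space, to be applied.\<close>
  define G where "G x = (if x \<in> \<Omega> then g x else 0)" for x
  have "(\<lambda>x. if x \<in> \<Omega> then (norm (g x))\<^sup>2 else 0) = (\<lambda>x. (norm (G x))\<^sup>2)"
    by (auto simp: G_def)
  then have "integrable lebesgue (\<lambda>x. (norm (G x))\<^sup>2)"
    using Lebesgue_Measure.integrable_restrict_UNIV[OF S, of "\<lambda>x. (norm (g x))\<^sup>2"] g
    by (simp add: L2_def)
  moreover have "G \<in> borel_measurable lebesgue"
    unfolding G_def[abs_def] using g S
    by (intro borel_measurable_if_I) (auto simp: L2_def)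
  ultimately have G: "G \<in> L2 UNIV"
    by (simp add: L2_def lebesgue_on_UNIV_eq)
  \<comment> \<open>Square integrability gives local integrability, by pairing with the indicator of
    the box.\<close>
  have int_cbox: "set_integrable lebesgue (cbox a b) G" for a b
    using L2_integrable_mult[OF indicator_cbox_L2 G, of a b]
    by (simp add: set_integrable_def lebesgue_on_UNIV_eq)
  have zero: "integral (cbox a b) G = 0" if sub: "cbox a b \<subseteq> \<Omega>" for a b
  proof -
    have bump: "box_bump a b n \<in> test_functions \<Omega>" for n
      using sub by (rule box_bump_test_function)
    have eq: "(\<lambda>x. G x * box_bump a b n x) = (\<lambda>x. if x \<in> \<Omega> then g x * box_bump a b n x else 0)" for n
      by (auto simp: G_def)
    have "(LINT x|lebesgue. G x * box_bump a b n x) = 0" for n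
      unfolding eq using S orth[OF bump] by (simp add: Lebesgue_Measure.integral_restrict_UNIV)
    moreover have "(\<lambda>n. LINT x|lebesgue. G x * box_bump a b n x) \<longlonglongrightarrow>
        (LINT x|lebesgue. G x * indicator (box a b) x)"
    proof (rule integral_dominated_convergence)
      show "integrable lebesgue (\<lambda>x. \<bar>indicator (cbox a b) x * G x\<bar>)"
        using int_cbox[of a b] by (simp add: set_integrable_def)
      have "box_bump a b n \<in> borel_measurable lebesgue" for n
        using test_functions_measurable(1)[OF bump] by (intro measurable_completion) simp
      then show "(\<lambda>x. G x * box_bump a b n x) \<in> borel_measurable lebesgue" for n
        by (intro borel_measurable_times \<open>G \<in> borel_measurable lebesgue\<close>)
      show "(\<lambda>x. G x * indicator (box a b) x) \<in> borel_measurable lebesgue"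
        by (intro borel_measurable_times borel_measurable_indicator \<open>G \<in> borel_measurable lebesgue\<close>
            fmeasurableD lmeasurable_box)
      show "AE x in lebesgue. (\<lambda>n. G x * box_bump a b n x) \<longlonglongrightarrow> G x * indicator (box a b) x"
        by (intro always_eventually allI tendsto_mult tendsto_const box_bump_tendsto)
      show "AE x in lebesgue. norm (G x * box_bump a b n x) \<le> \<bar>indicator (cbox a b) x * G x\<bar>" for n
      proof (intro always_eventually allI)
        fix x
        show "norm (G x * box_bump a b n x) \<le> \<bar>indicator (cbox a b) x * G x\<bar>"
        proof (cases "x \<in> box a b")
          case True
          then have "x \<in> cbox a b" using box_subset_cbox[of a b] by auto
          then show ?thesis
            using box_bump_bounds[of a b n x] by (simp add: abs_mult mult_left_le)
        qed (simp add: box_bump_eq_0)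
      qed
    qed
    ultimately have "(LINT x|lebesgue. G x * indicator (box a b) x) = 0"
      by (simp add: LIMSEQ_const_iff)
    moreover have "set_integrable lebesgue (box a b) G"
      by (rule set_integrable_subset[OF int_cbox[of a b] _ box_subset_cbox]) simp
    ultimately have "integral (box a b) G = 0"
      using set_lebesgue_integral_eq_integral(2)[of "box a b" G]
      by (simp add: set_lebesgue_integral_def mult.commute)
    then show ?thesis
      by (simp add: integral_open_interval)
  qed
  have "G integrable_on cbox a b" for a b
    using int_cbox by (rule set_lebesgue_integral_eq_integral(1))
  then obtain N where N: "negligible N"
    and diff: "\<And>x e. \<lbrakk>x \<notin> N; 0 < e\<rbrakk> \<Longrightarrow> \<exists>d>0. \<forall>h. 0 < h \<and> h < d \<longrightarrow>
      norm (integral (cbox x (x + h *\<^sub>R One)) G /\<^sub>R h ^ DIM('a) - G x) < e"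
    using integrable_ccontinuous_explicit[of G] by blast
  have "g x = 0" if "x \<in> \<Omega>" "x \<notin> N" for x
  proof (rule ccontr)
    assume "g x \<noteq> 0"
    \<comment> \<open>Tolerance \<open>\<bar>g x\<bar>\<close> is enough: an average equal to 0 has
      distance exactly \<open>\<bar>g x\<bar>\<close> from the value at \<open>x\<close>.\<close>
    then have "0 < \<bar>g x\<bar>" by simp
    from diff[OF \<open>x \<notin> N\<close> this] obtain d where d: "d > 0" "\<And>h. 0 < h \<Longrightarrow> h < d \<Longrightarrow>
        norm (integral (cbox x (x + h *\<^sub>R One)) G /\<^sub>R h ^ DIM('a) - G x) < \<bar>g x\<bar>"
      by blast
    from \<Omega> \<open>x \<in> \<Omega>\<close> obtain r where r: "r > 0" "cball x r \<subseteq> \<Omega>"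
      unfolding open_contains_cball by blast
    \<comment> \<open>Half of \<open>d\<close> keeps \<open>h\<close> strictly below
      \<open>d\<close>. Division by the dimension places the cube in the ball, since the Euclidean
      norm is at most the sum of the coordinates' absolute values.\<close>
    define h where "h = min (d / 2) (r / DIM('a))"
    have h: "0 < h" "h < d" "DIM('a) * h \<le> r"
      using d(1) r(1) by (auto simp: h_def min_def field_simps)
    have "cbox x (x + h *\<^sub>R One) \<subseteq> cball x r"
    proof
      fix y assume y: "y \<in> cbox x (x + h *\<^sub>R One)"
      have "norm (y - x) \<le> (\<Sum>i\<in>Basis. \<bar>(y - x) \<bullet> i\<bar>)"
        by (rule norm_le_l1)
      also have "\<dots> \<le> (\<Sum>i\<in>(Basis::'a set). h)"
        using y by (intro sum_mono) (auto simp: mem_box algebra_simps)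
      also have "\<dots> \<le> r"
        using h by simp
      finally show "y \<in> cball x r"
        by (simp add: dist_norm norm_minus_commute)
    qed
    then have "integral (cbox x (x + h *\<^sub>R One)) G = 0"
      using r by (intro zero) auto
    then show False
      using d(2)[OF h(1,2)] \<open>x \<in> \<Omega>\<close> by (simp add: G_def)
  qed
  moreover have "AE x in lebesgue. x \<notin> N"
    using N by (intro AE_not_in) (simp add: negligible_iff_null_sets)
  ultimately show ?thesis
    using S by (auto simp: AE_restrict_space_iff elim: eventually_mono)
qed

section \<open>Weak gradients and integration by parts\<close>

text \<open>Each component of the difference of two weak gradients is orthogonal to all test
  functions, so the fundamental lemma applies.\<close>

lemma is_weak_grad_unique:
  fixes g g' :: "real^'n \<Rightarrow> real^'n"
  assumes "open \<Omega>" and g: "is_weak_grad \<Omega> w g" and g': "is_weak_grad \<Omega> w g'"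
  shows "AE x in lebesgue_on \<Omega>. g x = g' x"
proof -
  have L2: "g \<in> L2 \<Omega>" "g' \<in> L2 \<Omega>"
    using g g' by (auto simp: is_weak_grad_def)
  have "AE x in lebesgue_on \<Omega>. g x $ i - g' x $ i = 0" for i
  proof (rule L2_orthogonal_test_functions_imp_0[OF \<open>open \<Omega>\<close>])
    show "(\<lambda>x. g x $ i - g' x $ i) \<in> L2 \<Omega>"
      using L2 by (intro L2_diff L2_component)
    fix \<phi> :: "real^'n \<Rightarrow> real"
    assume \<phi>: "\<phi> \<in> test_functions \<Omega>"
    have "integrable (lebesgue_on \<Omega>) (\<lambda>x. g x $ i * \<phi> x)"
      "integrable (lebesgue_on \<Omega>) (\<lambda>x. g' x $ i * \<phi> x)"
      using L2 \<phi> \<open>open \<Omega>\<close> by (auto intro!: L2_integrable_mult L2_component test_functions_L2)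
    moreover have "(LINT x|lebesgue_on \<Omega>. w x * gradient \<phi> x $ i) = - (LINT x|lebesgue_on \<Omega>. g x $ i * \<phi> x)"
      using g \<phi> by (simp add: is_weak_grad_def)
    moreover have "(LINT x|lebesgue_on \<Omega>. w x * gradient \<phi> x $ i) = - (LINT x|lebesgue_on \<Omega>. g' x $ i * \<phi> x)"
      using g' \<phi> by (simp add: is_weak_grad_def)
    ultimately show "(LINT x|lebesgue_on \<Omega>. (g x $ i - g' x $ i) * \<phi> x) = 0"
      by (simp add: left_diff_distrib)
  qed
  then have "AE x in lebesgue_on \<Omega>. \<forall>i\<in>UNIV. g x $ i - g' x $ i = 0"
    by (intro AE_finite_allI) auto
  then show ?thesis
    by (rule eventually_mono) (simp add: vec_eq_iff)
qed

lemma is_weak_grad_diff: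
  assumes \<Omega>: "open \<Omega>" and wv: "w \<in> L2 \<Omega>" "v \<in> L2 \<Omega>"
    and g: "is_weak_grad \<Omega> w g" and h: "is_weak_grad \<Omega> v h"
  shows "is_weak_grad \<Omega> (\<lambda>x. w x - v x) (\<lambda>x. g x - h x)"
  unfolding is_weak_grad_def
proof (intro conjI ballI allI)
  have L2: "g \<in> L2 \<Omega>" "h \<in> L2 \<Omega>"
    using g h by (auto simp: is_weak_grad_def)
  then show "(\<lambda>x. g x - h x) \<in> L2 \<Omega>"
    by (rule L2_diff)
  fix \<phi> i
  assume \<phi>: "\<phi> \<in> test_functions \<Omega>"
  have "integrable (lebesgue_on \<Omega>) (\<lambda>x. g x $ i * \<phi> x)"
    "integrable (lebesgue_on \<Omega>) (\<lambda>x. h x $ i * \<phi> x)"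
    "integrable (lebesgue_on \<Omega>) (\<lambda>x. w x * gradient \<phi> x $ i)"
    "integrable (lebesgue_on \<Omega>) (\<lambda>x. v x * gradient \<phi> x $ i)"
    using \<Omega> L2 wv \<phi>
    by (auto intro!: L2_integrable_mult L2_component test_functions_L2 gradient_L2)
  then show "(LINT x|lebesgue_on \<Omega>. (w x - v x) * gradient \<phi> x $ i) =
      - (LINT x|lebesgue_on \<Omega>. (g x - h x) $ i * \<phi> x)"
    using g h \<phi> by (simp add: left_diff_distrib is_weak_grad_def)
qed

lemma is_weak_grad_weak_grad: "w \<in> H1 \<Omega> \<Longrightarrow> is_weak_grad \<Omega> w (weak_grad \<Omega> w)"
  unfolding weak_grad_def H1_def by (auto intro: someI[of "is_weak_grad \<Omega> w"])

lemma weak_grad_L2: "w \<in> H1 \<Omega> \<Longrightarrow> weak_grad \<Omega> w \<in> L2 \<Omega>"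
  using is_weak_grad_weak_grad by (auto simp: is_weak_grad_def)

lemma H1_L2: "w \<in> H1 \<Omega> \<Longrightarrow> w \<in> L2 \<Omega>"
  by (simp add: H1_def)

lemma H01_H1: "w \<in> H01 \<Omega> \<Longrightarrow> w \<in> H1 \<Omega>"
  by (simp add: H01_def)

lemma H1_diff: "open \<Omega> \<Longrightarrow> w \<in> H1 \<Omega> \<Longrightarrow> v \<in> H1 \<Omega> \<Longrightarrow> (\<lambda>x. w x - v x) \<in> H1 \<Omega>"
  unfolding H1_def by (blast intro: L2_diff is_weak_grad_diff)

lemma test_functions_H1: "open \<Omega> \<Longrightarrow> \<phi> \<in> test_functions \<Omega> \<Longrightarrow> \<phi> \<in> H1 \<Omega>"
  using is_weak_grad_gradient test_functions_L2 unfolding H1_def by blast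

text \<open>\<open>weak_grad\<close> is an arbitrary representative, so even for a test function it
  matches the classical gradient only almost everywhere, through uniqueness.\<close>

lemma weak_grad_test_function_AE:
  "open \<Omega> \<Longrightarrow> \<phi> \<in> test_functions \<Omega> \<Longrightarrow> AE x in lebesgue_on \<Omega>. weak_grad \<Omega> \<phi> x = gradient \<phi> x"
  by (intro is_weak_grad_unique[of _ \<phi>] is_weak_grad_weak_grad is_weak_grad_gradient test_functions_H1)

lemma weak_grad_diff_AE:
  "open \<Omega> \<Longrightarrow> w \<in> H1 \<Omega> \<Longrightarrow> v \<in> H1 \<Omega> \<Longrightarrow>
    AE x in lebesgue_on \<Omega>. weak_grad \<Omega> (\<lambda>x. w x - v x) x = weak_grad \<Omega> w x - weak_grad \<Omega> v x"
  by (intro is_weak_grad_unique[of _ "\<lambda>x. w x - v x"] is_weak_grad_weak_grad is_weak_grad_diff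
      H1_diff H1_L2)

lemma H1_norm_nonneg: "0 \<le> H1_norm \<Omega> w"
  by (simp add: H1_norm_def)

lemma H1_norm_power2: "(H1_norm \<Omega> w)\<^sup>2 = (L2_norm \<Omega> w)\<^sup>2 + (L2_norm \<Omega> (weak_grad \<Omega> w))\<^sup>2"
  by (simp add: H1_norm_def)

lemma L2_norm_le_H1_norm: "L2_norm \<Omega> w \<le> H1_norm \<Omega> w"
  and L2_norm_weak_grad_le_H1_norm: "L2_norm \<Omega> (weak_grad \<Omega> w) \<le> H1_norm \<Omega> w"
  by (auto intro!: power2_le_imp_le[OF _ H1_norm_nonneg] simp: H1_norm_power2)

lemma H1_norm_diff_power2_le:
  assumes \<Omega>: "open \<Omega>" and wv: "w \<in> H1 \<Omega>" "v \<in> H1 \<Omega>"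
  shows "(H1_norm \<Omega> (\<lambda>x. w x - v x))\<^sup>2 \<le> 2 * (H1_norm \<Omega> w)\<^sup>2 + 2 * (H1_norm \<Omega> v)\<^sup>2"
proof -
  note L2 = weak_grad_L2[OF wv(1)] weak_grad_L2[OF wv(2)] weak_grad_L2[OF H1_diff[OF \<Omega> wv]]
  have "L2_norm \<Omega> (weak_grad \<Omega> (\<lambda>x. w x - v x)) = L2_norm \<Omega> (\<lambda>x. weak_grad \<Omega> w x - weak_grad \<Omega> v x)"
    unfolding L2_norm_def
    using weak_grad_diff_AE[OF \<Omega> wv] L2 L2_diff[OF L2(1,2)]
    by (intro arg_cong[where f = sqrt] L2_inner_cong_AE L2_measurable)
  then show ?thesis
    using L2_norm_diff_power2_le[OF L2(1,2)] L2_norm_diff_power2_le[OF wv[THEN H1_L2]]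
    by (simp add: H1_norm_power2)
qed

lemma H01_diff:
  assumes \<Omega>: "open \<Omega>" and w: "w \<in> H01 \<Omega>" and v: "v \<in> H01 \<Omega>"
  shows "(\<lambda>x. w x - v x) \<in> H01 \<Omega>"
proof -
  obtain \<phi> where \<phi>: "\<And>k. \<phi> k \<in> test_functions \<Omega>" "(\<lambda>k. H1_norm \<Omega> (\<lambda>x. w x - \<phi> k x)) \<longlonglongrightarrow> 0"
    using w by (auto simp: H01_def)
  obtain \<psi> where \<psi>: "\<And>k. \<psi> k \<in> test_functions \<Omega>" "(\<lambda>k. H1_norm \<Omega> (\<lambda>x. v x - \<psi> k x)) \<longlonglongrightarrow> 0"
    using v by (auto simp: H01_def)
  let ?N = "\<lambda>k. H1_norm \<Omega> (\<lambda>x. (w x - v x) - (\<phi> k x - \<psi> k x))"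
  \<comment> \<open>Regrouping the error as \<open>(w - \<phi> k) - (v - \<psi> k)\<close> reduces
    it to the two given approximation errors.\<close>
  have "(?N k)\<^sup>2 \<le> 2 * (H1_norm \<Omega> (\<lambda>x. w x - \<phi> k x))\<^sup>2 + 2 * (H1_norm \<Omega> (\<lambda>x. v x - \<psi> k x))\<^sup>2" for k
    using H1_norm_diff_power2_le[OF \<Omega> H1_diff[OF \<Omega> H01_H1[OF w] test_functions_H1[OF \<Omega> \<phi>(1)[of k]]]
        H1_diff[OF \<Omega> H01_H1[OF v] test_functions_H1[OF \<Omega> \<psi>(1)[of k]]]]
    by (simp add: algebra_simps)
  then have "\<forall>\<^sub>F k in sequentially. (?N k)\<^sup>2 \<le>
      2 * (H1_norm \<Omega> (\<lambda>x. w x - \<phi> k x))\<^sup>2 + 2 * (H1_norm \<Omega> (\<lambda>x. v x - \<psi> k x))\<^sup>2"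
    by (intro always_eventually allI)
  moreover have "(\<lambda>k. 2 * (H1_norm \<Omega> (\<lambda>x. w x - \<phi> k x))\<^sup>2 + 2 * (H1_norm \<Omega> (\<lambda>x. v x - \<psi> k x))\<^sup>2)
      \<longlonglongrightarrow> 2 * 0\<^sup>2 + 2 * 0\<^sup>2"
    by (intro tendsto_intros \<phi>(2) \<psi>(2))
  then have "(\<lambda>k. 2 * (H1_norm \<Omega> (\<lambda>x. w x - \<phi> k x))\<^sup>2 + 2 * (H1_norm \<Omega> (\<lambda>x. v x - \<psi> k x))\<^sup>2)
      \<longlonglongrightarrow> 0"
    by simp
  ultimately have "(\<lambda>k. (?N k)\<^sup>2) \<longlonglongrightarrow> 0"
    by (rule tendsto_sandwich[OF always_eventually[OF allI[OF zero_le_power2]] _ tendsto_const])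
  then have "?N \<longlonglongrightarrow> 0"
    using tendsto_real_sqrt[of "\<lambda>k. (?N k)\<^sup>2" 0] by (simp add: H1_norm_nonneg)
  moreover have "(\<lambda>x. w x - v x) \<in> H1 \<Omega>"
    using \<Omega> w v by (intro H1_diff H01_H1)
  ultimately show ?thesis
    using test_functions_diff[OF \<phi>(1) \<psi>(1)] unfolding H01_def mem_Collect_eq
    by (intro conjI exI[of _ "\<lambda>k x. \<phi> k x - \<psi> k x"] allI)
qed

text \<open>The chosen weak gradient of 0 may be nonzero on a null set, so its norm needs an
  argument. The result makes a constant sequence admissible for showing that test functions lie in
  \<open>H01\<close>.\<close>

lemma H1_norm_zero:
  fixes \<Omega> :: "(real^'n) set"
  assumes \<Omega>: "open \<Omega>"
  shows "H1_norm \<Omega> (\<lambda>x. 0) = 0"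
proof -
  have "(\<lambda>x. 0) \<in> test_functions \<Omega>"
    by (rule test_functionsI[of _ "{}"]) (auto intro: C_k_const)
  from weak_grad_test_function_AE[OF \<Omega> this]
  have "AE x in lebesgue_on \<Omega>. weak_grad \<Omega> (\<lambda>x. 0) x \<bullet> weak_grad \<Omega> (\<lambda>x. 0) x = 0"
    by eventually_elim (simp add: gradient_def zero_vec_def)
  then have "L2_norm \<Omega> (weak_grad \<Omega> (\<lambda>x. 0)) = 0"
    unfolding L2_norm_def L2_inner_def by (simp add: integral_eq_zero_AE)
  then show ?thesis
    by (simp add: H1_norm_def L2_norm_def L2_inner_def)
qed

lemma test_functions_H01:
  assumes "open \<Omega>" "\<phi> \<in> test_functions \<Omega>"
  shows "\<phi> \<in> H01 \<Omega>"
  unfolding H01_def mem_Collect_eq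
  using assms by (intro conjI test_functions_H1 exI[of _ "\<lambda>_. \<phi>"] allI) (simp_all add: H1_norm_zero)

section \<open>Fields with square integrable divergence and integration by parts\<close>

lemma is_weak_div_weak_div: "y \<in> Hdiv \<Omega> \<Longrightarrow> is_weak_div \<Omega> y (weak_div \<Omega> y)"
  unfolding weak_div_def Hdiv_def by (auto intro: someI[of "is_weak_div \<Omega> y"])

lemma weak_div_L2: "y \<in> Hdiv \<Omega> \<Longrightarrow> weak_div \<Omega> y \<in> L2 \<Omega>"
  using is_weak_div_weak_div by (auto simp: is_weak_div_def)

lemma Hdiv_L2: "y \<in> Hdiv \<Omega> \<Longrightarrow> y \<in> L2 \<Omega>"
  by (simp add: Hdiv_def)

text \<open>For test functions this is the definition of the weak divergence. Both sides are
  continuous in the \<open>H1_norm\<close>, so the identity passes to the closure.\<close>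

lemma H01_integration_by_parts:
  assumes \<Omega>: "open \<Omega>" and y: "y \<in> Hdiv \<Omega>" and w: "w \<in> H01 \<Omega>"
  shows "L2_inner \<Omega> y (weak_grad \<Omega> w) = - L2_inner \<Omega> (weak_div \<Omega> y) w"
proof -
  obtain \<phi> where \<phi>: "\<And>k. \<phi> k \<in> test_functions \<Omega>" "(\<lambda>k. H1_norm \<Omega> (\<lambda>x. w x - \<phi> k x)) \<longlonglongrightarrow> 0"
    using w by (auto simp: H01_def)
  define D where "D = L2_inner \<Omega> y (weak_grad \<Omega> w) + L2_inner \<Omega> (weak_div \<Omega> y) w"
  have H1: "w \<in> H1 \<Omega>" "\<phi> k \<in> H1 \<Omega>" "(\<lambda>x. w x - \<phi> k x) \<in> H1 \<Omega>" for k
    using H01_H1[OF w] test_functions_H1[OF \<Omega> \<phi>(1)] H1_diff[OF \<Omega>] by auto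
  have bound: "\<bar>D\<bar> \<le> (L2_norm \<Omega> y + L2_norm \<Omega> (weak_div \<Omega> y)) * H1_norm \<Omega> (\<lambda>x. w x - \<phi> k x)" for k
  proof -
    let ?r = "\<lambda>x. w x - \<phi> k x"
    have grad: "AE x in lebesgue_on \<Omega>. weak_grad \<Omega> ?r x = weak_grad \<Omega> w x - gradient (\<phi> k) x"
      using weak_grad_diff_AE[OF \<Omega> H1(1) H1(2)[of k]] weak_grad_test_function_AE[OF \<Omega> \<phi>(1)[of k]]
      by eventually_elim simp
    have L2: "y \<in> L2 \<Omega>" "weak_grad \<Omega> w \<in> L2 \<Omega>" "gradient (\<phi> k) \<in> L2 \<Omega>" "weak_div \<Omega> y \<in> L2 \<Omega>"
        "w \<in> L2 \<Omega>" "\<phi> k \<in> L2 \<Omega>" "weak_grad \<Omega> ?r \<in> L2 \<Omega>" "?r \<in> L2 \<Omega>"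
      using \<Omega> H1 \<phi>(1) y
      by (auto intro: Hdiv_L2 weak_grad_L2 gradient_L2 weak_div_L2 H1_L2)
    have "L2_inner \<Omega> y (weak_grad \<Omega> ?r) = L2_inner \<Omega> y (\<lambda>x. weak_grad \<Omega> w x - gradient (\<phi> k) x)"
      using L2 grad by (intro L2_inner_cong_AE L2_measurable L2_diff) auto
    also have "\<dots> = L2_inner \<Omega> y (weak_grad \<Omega> w) - L2_inner \<Omega> y (gradient (\<phi> k))"
      using L2 by (intro L2_inner_diff_right)
    also have "L2_inner \<Omega> y (gradient (\<phi> k)) = - L2_inner \<Omega> (weak_div \<Omega> y) (\<phi> k)"
      using is_weak_div_weak_div[OF y] \<phi>(1)[of k] by (simp add: is_weak_div_def L2_inner_def)
    \<comment> \<open>The defect \<open>D\<close> is linear in \<open>w\<close> and vanishes on test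
      functions, so \<open>w\<close> may be replaced by the remainder \<open>w - \<phi> k\<close>,
      whose norm tends to 0.\<close>
    finally have "D = L2_inner \<Omega> y (weak_grad \<Omega> ?r) + L2_inner \<Omega> (weak_div \<Omega> y) ?r"
      using L2 by (simp add: D_def L2_inner_diff_right)
    also have "\<bar>\<dots>\<bar> \<le> L2_norm \<Omega> y * L2_norm \<Omega> (weak_grad \<Omega> ?r) + L2_norm \<Omega> (weak_div \<Omega> y) * L2_norm \<Omega> ?r"
      using abs_L2_inner_le[OF L2(1,7)] abs_L2_inner_le[OF L2(4,8)] by linarith
    also have "\<dots> \<le> L2_norm \<Omega> y * H1_norm \<Omega> ?r + L2_norm \<Omega> (weak_div \<Omega> y) * H1_norm \<Omega> ?r"
      by (intro add_mono mult_left_mono L2_norm_le_H1_norm L2_norm_weak_grad_le_H1_norm L2_norm_nonneg)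
    finally show ?thesis by (simp add: distrib_right)
  qed
  have "(\<lambda>k. (L2_norm \<Omega> y + L2_norm \<Omega> (weak_div \<Omega> y)) * H1_norm \<Omega> (\<lambda>x. w x - \<phi> k x))
      \<longlonglongrightarrow> (L2_norm \<Omega> y + L2_norm \<Omega> (weak_div \<Omega> y)) * 0"
    by (intro tendsto_intros \<phi>(2))
  then have "\<bar>D\<bar> \<le> (L2_norm \<Omega> y + L2_norm \<Omega> (weak_div \<Omega> y)) * 0"
    by (rule LIMSEQ_le_const) (use bound in auto)
  then show ?thesis by (simp add: D_def)
qed

text \<open>Used to derive the sign of the Friedrichs constant. Were all these norms zero, every
  \<open>L2\<close> function would be orthogonal to all test functions; the indicator of a ball
  would then vanish almost everywhere, although a ball has positive measure.\<close>

lemma exists_test_function_L2_norm_pos: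
  assumes \<Omega>: "open \<Omega>" "\<Omega> \<noteq> {}"
  shows "\<exists>\<phi>\<in>test_functions \<Omega>. 0 < L2_norm \<Omega> \<phi>"
proof (rule ccontr)
  assume neg: "\<not> ?thesis"
  from \<Omega>(2) obtain x where "x \<in> \<Omega>" by blast
  with \<Omega>(1) obtain r where x: "0 < r" "cball x r \<subseteq> \<Omega>"
    unfolding open_contains_cball by blast
  define g where "g = indicat_real (cball x r)"
  have g: "g \<in> L2 \<Omega>"
    unfolding g_def
  proof (rule indicator_L2)
    show "cball x r \<in> sets (lebesgue_on \<Omega>)"
      using x(2) \<Omega> by (auto simp: sets_restrict_space_iff)
    show "emeasure (lebesgue_on \<Omega>) (cball x r) < \<infinity>"
      using x(2) \<Omega> emeasure_lborel_cball_finite[of x r] by (simp add: emeasure_restrict_space)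
  qed
  have "(LINT x|lebesgue_on \<Omega>. g x * \<phi> x) = 0" if \<phi>: "\<phi> \<in> test_functions \<Omega>" for \<phi>
  proof -
    have "L2_norm \<Omega> \<phi> = 0"
      using neg \<phi> L2_norm_nonneg[of \<Omega> \<phi>] by (meson antisym not_le)
    then show ?thesis
      using abs_L2_inner_le[OF g test_functions_L2[OF \<Omega>(1) \<phi>]] by (simp add: L2_inner_def)
  qed
  from L2_orthogonal_test_functions_imp_0[OF \<Omega>(1) g this]
  have "AE y in lebesgue. y \<in> \<Omega> \<longrightarrow> g y = 0"
    using \<Omega>(1) by (simp add: AE_restrict_space_iff)
  then have "AE y in lebesgue. y \<notin> ball x r"
    by (rule eventually_mono) (use x(2) in \<open>auto simp: g_def indicator_def subset_iff split: if_splits\<close>)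
  then have "negligible (ball x r)"
    by (simp add: negligible_iff_null_sets AE_iff_null_sets)
  then show False
    using x(1) open_not_negligible[of "ball x r"] by auto
qed

section \<open>The symmetrized coefficient matrix\<close>

lemma matrix_inv_invertible:
  fixes a :: "'a::semiring_1^'n^'m"
  assumes "invertible a"
  shows "a ** matrix_inv a = mat 1" "matrix_inv a ** a = mat 1"
proof -
  have "\<exists>b. a ** b = mat 1 \<and> b ** a = mat 1"
    using assms by (simp add: invertible_def)
  from someI_ex[OF this] show "a ** matrix_inv a = mat 1" "matrix_inv a ** a = mat 1"
    by (simp_all add: matrix_inv_def)
qed

lemma matrix_inv_eqI:
  fixes a :: "'a::semiring_1^'n^'m"
  assumes "a ** b = mat 1" "b ** a = mat 1"
  shows "matrix_inv a = b"
proof -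
  have "invertible a"
    using assms by (auto simp: invertible_def)
  then have "matrix_inv a = (b ** a) ** matrix_inv a"
    using assms(2) by simp
  also have "\<dots> = b"
    using matrix_inv_invertible(1)[OF \<open>invertible a\<close>] by (simp flip: matrix_mul_assoc)
  finally show ?thesis .
qed

text \<open>Coercivity forces a trivial kernel, which suffices for a square matrix. No symmetry
  enters, so the result serves both the coefficient matrix and its symmetrization.\<close>

lemma coercive_imp_invertible:
  fixes a :: "real^'n^'n"
  assumes "c > 0" "\<And>\<xi>. c * (norm \<xi>)\<^sup>2 \<le> (a *v \<xi>) \<bullet> \<xi>"
  shows "invertible a"
proof -
  have "\<xi> = 0" if "a *v \<xi> = 0" for \<xi>
    using assms(2)[of \<xi>] that \<open>c > 0\<close> by (simp add: mult_le_0_iff)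
  then show ?thesis
    unfolding invertible_left_inverse matrix_left_invertible_ker by blast
qed

lemma inner_symmetrization:
  fixes a :: "real^'n^'n"
  shows "((a + transpose a) *v \<xi>) \<bullet> \<zeta> = (a *v \<xi>) \<bullet> \<zeta> + (a *v \<zeta>) \<bullet> \<xi>"
  by (simp add: matrix_vector_mult_add_rdistrib inner_add_left dot_lmul_matrix inner_commute[of _ \<xi>])

lemma symmetrization_coercive:
  fixes a :: "real^'n^'n"
  assumes "\<And>\<xi>. c * (norm \<xi>)\<^sup>2 \<le> (a *v \<xi>) \<bullet> \<xi>"
  shows "2 * c * (norm \<xi>)\<^sup>2 \<le> ((a + transpose a) *v \<xi>) \<bullet> \<xi>"
  using assms[of \<xi>] by (simp add: inner_symmetrization)

text \<open>Since \<open>I + a\<^sup>T a\<^sup>-\<^sup>1 = (a + a\<^sup>T) a\<^sup>-\<^sup>1\<close>, the matrix \<open>B\<close> equals \<open>a (a + a\<^sup>T)\<^sup>-\<^sup>1\<close>.\<close>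

lemma symmetrization_inverse:
  fixes a :: "real^'n^'n" and \<eta> :: "real^'n"
  assumes "c > 0" and coer: "\<And>\<xi>. c * (norm \<xi>)\<^sup>2 \<le> (a *v \<xi>) \<bullet> \<xi>"
  defines "z \<equiv> matrix_inv (mat 1 + transpose a ** matrix_inv a) *v \<eta>"
  shows "(a + transpose a) *v (matrix_inv a *v z) = \<eta>" "a *v (matrix_inv a *v z) = z"
proof -
  let ?s = "a + transpose a"
  note a = matrix_inv_invertible[OF coercive_imp_invertible[OF \<open>c > 0\<close> coer]]
  have "invertible ?s"
    using \<open>c > 0\<close> by (intro coercive_imp_invertible[of "2 * c"] symmetrization_coercive coer) simp
  note s = matrix_inv_invertible[OF this]
  have "?s ** matrix_inv a = a ** matrix_inv a + transpose a ** matrix_inv a"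
    by (simp add: matrix_matrix_mult_def vec_eq_iff sum.distrib distrib_right)
  then have eq: "mat 1 + transpose a ** matrix_inv a = ?s ** matrix_inv a"
    by (simp add: a(1))
  have "(?s ** matrix_inv a) ** (a ** matrix_inv ?s) = ?s ** (matrix_inv a ** a) ** matrix_inv ?s"
    by (simp only: matrix_mul_assoc)
  moreover have "(a ** matrix_inv ?s) ** (?s ** matrix_inv a) = a ** (matrix_inv ?s ** ?s) ** matrix_inv a"
    by (simp only: matrix_mul_assoc)
  ultimately have "matrix_inv (?s ** matrix_inv a) = a ** matrix_inv ?s"
    by (intro matrix_inv_eqI) (simp_all add: a s)
  then have z: "z = a *v (matrix_inv ?s *v \<eta>)"
    by (simp add: z_def eq matrix_vector_mul_assoc)
  \<comment> \<open>The factor \<open>a\<close> of \<open>B\<close> cancels, leaving the solution of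
    the symmetrized system with right-hand side \<eta>.\<close>
  have w: "matrix_inv a *v z = matrix_inv ?s *v \<eta>"
    unfolding z matrix_vector_mul_assoc[of "matrix_inv a"] a by simp
  show "?s *v (matrix_inv a *v z) = \<eta>"
    unfolding w matrix_vector_mul_assoc s by simp
  show "a *v (matrix_inv a *v z) = z"
    unfolding w by (simp add: z)
qed

text \<open>Cauchy--Schwarz for the inner product \<open>\<xi>, \<zeta> \<mapsto> (a + a\<^sup>T) \<xi> \<bullet> \<zeta>\<close>, whose quadratic form is
  twice that of \<open>a\<close>.\<close>

lemma abs_inner_symmetrization_le:
  fixes a :: "real^'n^'n"
  assumes nonneg: "\<And>\<xi>. 0 \<le> (a *v \<xi>) \<bullet> \<xi>"
  shows "\<bar>((a + transpose a) *v \<xi>) \<bullet> \<zeta>\<bar> \<le> 2 * sqrt ((a *v \<xi>) \<bullet> \<xi>) * sqrt ((a *v \<zeta>) \<bullet> \<zeta>)"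
proof -
  define p where "p = (a *v \<xi>) \<bullet> \<xi>"
  define q where "q = (a *v \<zeta>) \<bullet> \<zeta>"
  define r where "r = ((a + transpose a) *v \<xi>) \<bullet> \<zeta>"
  have quad: "0 \<le> s\<^sup>2 * p + s * t * r + t\<^sup>2 * q" for s t
  proof -
    have "0 \<le> (a *v (s *\<^sub>R \<xi> + t *\<^sub>R \<zeta>)) \<bullet> (s *\<^sub>R \<xi> + t *\<^sub>R \<zeta>)"
      by (rule nonneg)
    also have "\<dots> = s\<^sup>2 * p + s * t * r + t\<^sup>2 * q"
      unfolding p_def q_def r_def inner_symmetrization
      by (simp add: matrix_vector_right_distrib
          inner_add_left inner_add_right power2_eq_square algebra_simps)
    finally show ?thesis .
  qed
  have pq: "0 \<le> p" "0 \<le> q"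
    using nonneg by (auto simp: p_def q_def)
  have "r\<^sup>2 \<le> 4 * p * q"
  proof (cases "p = 0")
    case True
    have "r = 0"
    proof (rule ccontr)
      assume "r \<noteq> 0"
      \<comment> \<open>With \<open>p = 0\<close> the quadratic form is affine in \<open>s\<close>,
        and this choice of \<open>s\<close> gives it the value -1.\<close>
      then show False
        using quad[of "- (q + 1) / r" 1] True by (simp add: field_simps)
    qed
    then show ?thesis using pq by simp
  next
    case False
    \<comment> \<open>The discriminant argument: \<open>s = - r\<close> and \<open>t = 2 * p\<close>
      turn the form into exactly this product.\<close>
    have "0 \<le> p * (4 * p * q - r\<^sup>2)"
      using quad[of "- r" "2 * p"] by (simp add: power2_eq_square algebra_simps)
    then show ?thesis
      using False pq by (simp add: zero_le_mult_iff)
  qed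
  also have "\<dots> = (2 * sqrt p * sqrt q)\<^sup>2"
    using pq by (simp add: power_mult_distrib)
  finally have "\<bar>r\<bar>\<^sup>2 \<le> (2 * sqrt p * sqrt q)\<^sup>2"
    by simp
  then have "\<bar>r\<bar> \<le> 2 * sqrt p * sqrt q"
    by (rule power2_le_imp_le) (use pq in simp)
  then show ?thesis
    by (simp add: p_def q_def r_def)
qed

section \<open>Measurability of solutions of linear systems with measurable coefficients\<close>

lemma borel_measurable_det:
  fixes M :: "'a \<Rightarrow> real^'n^'n"
  assumes "\<And>i j. (\<lambda>x. M x $ i $ j) \<in> borel_measurable N"
  shows "(\<lambda>x. det (M x)) \<in> borel_measurable N"
  unfolding det_def
  by (intro borel_measurable_sum borel_measurable_times borel_measurable_prod assms measurable_const) simp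

text \<open>Cramer's rule expresses the solution by quotients of determinants, which are polynomials
  in measurable entries. Division by 0 yields 0, so \<open>q\<close> is measurable everywhere,
  including where the matrix is singular.\<close>

lemma borel_measurable_matrix_solution:
  fixes S :: "'a \<Rightarrow> real^'n^'n" and f :: "'a \<Rightarrow> real^'n"
  assumes S: "S \<in> borel_measurable N" and f: "f \<in> borel_measurable N"
  shows "\<exists>q\<in>borel_measurable N. \<forall>x w. invertible (S x) \<longrightarrow> S x *v w = f x \<longrightarrow> q x = w"
proof -
  define q where "q x = (\<chi> k. det (\<chi> i j. if j = k then f x $ i else S x $ i $ j) / det (S x))" for x
  have Sij: "(\<lambda>x. S x $ i $ j) \<in> borel_measurable N" for i j
    using S by (intro borel_measurable_vec_nth)
  have fi: "(\<lambda>x. f x $ i) \<in> borel_measurable N" for i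
    using f by (rule borel_measurable_vec_nth)
  have "(\<lambda>x. if j = k then f x $ i else S x $ i $ j) \<in> borel_measurable N" for i j k
    using Sij fi by (cases "j = k") auto
  then have "q \<in> borel_measurable N"
    unfolding q_def[abs_def]
    by (intro borel_measurable_vec_lambda borel_measurable_divide borel_measurable_det)
      (auto simp: Sij)
  moreover have "q x = w" if "invertible (S x)" "S x *v w = f x" for x w
    using that cramer[of "S x" w "f x"] by (simp add: q_def invertible_det_nz)
  ultimately show ?thesis by blast
qed

text \<open>Completeness of Lebesgue measure: changes on a null set preserve measurability. The
  extension by zero transfers this to \<Omega>.\<close>

lemma borel_measurable_lebesgue_on_AE:
  fixes f :: "'a::euclidean_space \<Rightarrow> 'b::euclidean_space"
  assumes S: "S \<in> sets lebesgue" and f: "f \<in> borel_measurable (lebesgue_on S)"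
    and ae: "AE x in lebesgue_on S. f x = g x"
  shows "g \<in> borel_measurable (lebesgue_on S)"
proof -
  have "(\<lambda>x. if x \<in> S then f x else 0) \<in> borel_measurable lebesgue"
    using S f by (simp add: borel_measurable_if)
  moreover have "AE x in lebesgue. (if x \<in> S then f x else 0) = (if x \<in> S then g x else 0)"
    using ae S by (auto simp: AE_restrict_space_iff elim: eventually_mono)
  ultimately have "(\<lambda>x. if x \<in> S then g x else 0) \<in> borel_measurable lebesgue"
    by (rule borel_measurable_AE)
  then show ?thesis
    using S by (simp add: borel_measurable_if)
qed

section \<open>The error estimate in the energy norm\<close>

theorem theorem2p1:
  fixes \<Omega> :: "(real^'n) set"
    and f u v :: "real^'n \<Rightarrow> real"
    and A B :: "real^'n \<Rightarrow> real^'n^'n"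
    and c C\<^sub>F :: real
  assumes "domain \<Omega>" and "simply_connected \<Omega>" and "lipschitz_boundary \<Omega>"
    and "f \<in> L2 \<Omega>"
    and "A \<in> Linfty \<Omega>"
    and "\<exists>M. AE x in lebesgue_on \<Omega>. invertible (A x) \<and> norm (matrix_inv (A x)) \<le> M"
    and "c > 0"
    and "AE x in lebesgue_on \<Omega>. \<forall>\<xi>. (A x *v \<xi>) \<bullet> \<xi> \<ge> c * (norm \<xi>)\<^sup>2"
    and "\<forall>w \<in> H01 \<Omega>. L2_norm \<Omega> w \<le> C\<^sub>F * L2_norm \<Omega> (weak_grad \<Omega> w)"
    and "u \<in> H01 \<Omega>"
    and "\<forall>w \<in> H01 \<Omega>. L2_inner \<Omega> (\<lambda>x. A x *v weak_grad \<Omega> u x) (weak_grad \<Omega> w) = L2_inner \<Omega> f w"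
    and "v \<in> H01 \<Omega>"
    and "B = (\<lambda>x. matrix_inv (mat 1 + transpose (A x) ** matrix_inv (A x)))"
  shows "\<forall>y \<in> Hdiv \<Omega>.
    sqrt (L2_inner \<Omega> (\<lambda>x. A x *v weak_grad \<Omega> (\<lambda>x. u x - v x) x) (weak_grad \<Omega> (\<lambda>x. u x - v x)))
    \<le> 2 * sqrt (L2_inner \<Omega>
          (\<lambda>x. matrix_inv (A x) *v (B x *v (y x - A x *v weak_grad \<Omega> v x)))
          (\<lambda>x. B x *v (y x - A x *v weak_grad \<Omega> v x)))
      + C\<^sub>F / sqrt c * L2_norm \<Omega> (\<lambda>x. weak_div \<Omega> y x + f x)"
proof
  fix y assume y: "y \<in> Hdiv \<Omega>"
  have \<Omega>: "open \<Omega>" "\<Omega> \<noteq> {}"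
    using assms(1) by (auto simp: domain_def)
  have S: "\<Omega> \<in> sets lebesgue"
    using \<Omega>(1) by simp
  note coer = assms(8)
  have Am: "A \<in> borel_measurable (lebesgue_on \<Omega>)"
    using assms(5) by (simp add: Linfty_def)
  define e where "e x = u x - v x" for x
  define p where "p = weak_grad \<Omega> e"
  define \<eta> where "\<eta> x = y x - A x *v weak_grad \<Omega> v x" for x
  define z where "z x = B x *v \<eta> x" for x
  define w where "w x = matrix_inv (A x) *v z x" for x
  define E where "E = L2_inner \<Omega> (\<lambda>x. A x *v p x) p"
  define D where "D = L2_norm \<Omega> (\<lambda>x. weak_div \<Omega> y x + f x)"
  have e: "e \<in> H01 \<Omega>"
    unfolding e_def[abs_def] using \<Omega>(1) assms(10,12) by (rule H01_diff)
  have H1: "u \<in> H1 \<Omega>" "v \<in> H1 \<Omega>" "e \<in> H1 \<Omega>"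
    using assms(10,12) e by (auto intro: H01_H1)
  have p_diff: "AE x in lebesgue_on \<Omega>. p x = weak_grad \<Omega> u x - weak_grad \<Omega> v x"
    using weak_grad_diff_AE[OF \<Omega>(1) H1(1,2)] by (simp add: p_def e_def[abs_def])
  have L2: "y \<in> L2 \<Omega>" "weak_div \<Omega> y \<in> L2 \<Omega>" "weak_grad \<Omega> u \<in> L2 \<Omega>" "weak_grad \<Omega> v \<in> L2 \<Omega>"
      "p \<in> L2 \<Omega>" "e \<in> L2 \<Omega>" "f \<in> L2 \<Omega>"
    using y H1 assms(4) by (auto simp: p_def intro: Hdiv_L2 weak_div_L2 weak_grad_L2 H1_L2)
  have AL2: "(\<lambda>x. A x *v weak_grad \<Omega> u x) \<in> L2 \<Omega>" "(\<lambda>x. A x *v weak_grad \<Omega> v x) \<in> L2 \<Omega>"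
      "(\<lambda>x. A x *v p x) \<in> L2 \<Omega>"
    using L2 by (auto intro!: L2_matrix_vector_mult[OF assms(5)])
  have \<eta>L2: "\<eta> \<in> L2 \<Omega>"
    unfolding \<eta>_def[abs_def] using L2(1) AL2(2) by (rule L2_diff)
  have divL2: "(\<lambda>x. weak_div \<Omega> y x + f x) \<in> L2 \<Omega>"
    using L2(2,7) by (rule L2_add)

  \<comment> \<open>\<open>C\<^sub>F\<close> is only known to satisfy the Friedrichs inequality.
    Testing it with a function of positive norm yields the sign that later monotonicity steps
    require.\<close>
  have CF: "0 \<le> C\<^sub>F"
  proof -
    obtain \<phi> where \<phi>: "\<phi> \<in> test_functions \<Omega>" "0 < L2_norm \<Omega> \<phi>"
      using exists_test_function_L2_norm_pos[OF \<Omega>] by blast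
    then have "0 < C\<^sub>F * L2_norm \<Omega> (weak_grad \<Omega> \<phi>)"
      using assms(9) test_functions_H01[OF \<Omega>(1)] by (metis order_less_le_trans)
    then show ?thesis
      using L2_norm_nonneg[of \<Omega> "weak_grad \<Omega> \<phi>"] by (simp add: zero_less_mult_iff)
  qed

  have w: "AE x in lebesgue_on \<Omega>. (A x + transpose (A x)) *v w x = \<eta> x \<and> A x *v w x = z x"
    using coer
  proof eventually_elim
    case (elim x)
    then show ?case
      using symmetrization_inverse[OF \<open>c > 0\<close>, of "A x" "\<eta> x"]
      by (simp add: w_def z_def assms(13))
  qed
  have [measurable]: "(\<lambda>x. A x $ i $ j) \<in> borel_measurable (lebesgue_on \<Omega>)" for i j
    using Am by (intro borel_measurable_vec_nth)
  have "(\<lambda>x. \<chi> i. \<chi> j. A x $ i $ j + A x $ j $ i) \<in> borel_measurable (lebesgue_on \<Omega>)"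
    by (intro borel_measurable_vec_lambda) measurable
  also have "(\<lambda>x. \<chi> i. \<chi> j. A x $ i $ j + A x $ j $ i) = (\<lambda>x. A x + transpose (A x))"
    by (simp add: fun_eq_iff vec_eq_iff transpose_def)
  finally have Sm: "(\<lambda>x. A x + transpose (A x)) \<in> borel_measurable (lebesgue_on \<Omega>)" .
  \<comment> \<open>Measurability of \<open>w\<close> cannot be read off from
    \<open>matrix_inv\<close>, which is defined by choice. The measurable solution \<open>q\<close>
    of the symmetrized system agrees with \<open>w\<close> almost everywhere.\<close>
  from borel_measurable_matrix_solution[OF Sm L2_measurable[OF \<eta>L2]]
  obtain q where q: "q \<in> borel_measurable (lebesgue_on \<Omega>)"
    and q_eq: "\<And>x w. invertible (A x + transpose (A x)) \<Longrightarrow>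
      (A x + transpose (A x)) *v w = \<eta> x \<Longrightarrow> q x = w"
    by blast
  have qw: "AE x in lebesgue_on \<Omega>. q x = w x"
    using w coer
  proof eventually_elim
    case (elim x)
    have "invertible (A x + transpose (A x))"
      using \<open>c > 0\<close> elim
      by (intro coercive_imp_invertible[of "2 * c"] symmetrization_coercive) auto
    with elim show ?case
      by (intro q_eq) auto
  qed
  have wm: "w \<in> borel_measurable (lebesgue_on \<Omega>)"
    using S q qw by (rule borel_measurable_lebesgue_on_AE)
  \<comment> \<open>Coercivity of the symmetrized matrix with constant \<open>2 * c\<close>, tested
    with \<open>w x\<close>, gives a pointwise bound that makes \<open>w\<close> square
    integrable.\<close>
  have "AE x in lebesgue_on \<Omega>. norm (w x) \<le> (1 / (2 * c)) * norm (\<eta> x)"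
    using w coer
  proof eventually_elim
    case (elim x)
    then have "2 * c * (norm (w x))\<^sup>2 \<le> \<eta> x \<bullet> w x"
      using symmetrization_coercive[of c "A x" "w x"] by simp
    also have "\<dots> \<le> norm (\<eta> x) * norm (w x)"
      by (rule norm_cauchy_schwarz)
    finally have "norm (w x) * (2 * c * norm (w x)) \<le> norm (w x) * norm (\<eta> x)"
      by (simp add: power2_eq_square mult_ac)
    then have "2 * c * norm (w x) \<le> norm (\<eta> x)"
      by (cases "w x = 0") auto
    then show ?case
      using \<open>c > 0\<close> by (simp add: field_simps)
  qed
  then have wL2: "w \<in> L2 \<Omega>"
    by (rule L2_dominated[OF \<eta>L2 wm])
  have AwL2: "(\<lambda>x. A x *v w x) \<in> L2 \<Omega>"
    using L2_matrix_vector_mult[OF assms(5) wL2] .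
  have Aw_z: "AE x in lebesgue_on \<Omega>. A x *v w x = z x"
    using w by eventually_elim simp
  have zm: "z \<in> borel_measurable (lebesgue_on \<Omega>)"
    using S L2_measurable[OF AwL2] Aw_z by (rule borel_measurable_lebesgue_on_AE)
  define H where "H = L2_inner \<Omega> w z"
  \<comment> \<open>The flux term of the estimate is the energy of \<open>w\<close>, because
    \<open>z\<close> equals \<open>A w\<close> almost everywhere; in particular it is
    nonnegative.\<close>
  have H: "H = (LINT x|lebesgue_on \<Omega>. (A x *v w x) \<bullet> w x)"
  proof -
    have "H = L2_inner \<Omega> w (\<lambda>x. A x *v w x)"
      unfolding H_def
    proof (rule L2_inner_cong_AE)
      show "AE x in lebesgue_on \<Omega>. z x = A x *v w x"
        using Aw_z by eventually_elim simp
    qed (use wm zm L2_measurable[OF AwL2] in auto)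
    then show ?thesis
      by (simp add: L2_inner_def inner_commute)
  qed
  have nonneg: "AE x in lebesgue_on \<Omega>. \<forall>\<xi>. 0 \<le> (A x *v \<xi>) \<bullet> \<xi>"
    using coer
  proof eventually_elim
    case (elim x)
    have "0 \<le> c * (norm \<xi>)\<^sup>2" for \<xi> :: "real^'n"
      using \<open>c > 0\<close> by simp
    with elim show ?case
      using order_trans by blast
  qed
  then have nonneg_p: "AE x in lebesgue_on \<Omega>. 0 \<le> (A x *v p x) \<bullet> p x"
    and nonneg_w: "AE x in lebesgue_on \<Omega>. 0 \<le> (A x *v w x) \<bullet> w x"
    by (auto elim: eventually_mono)
  have E0: "0 \<le> E"
    unfolding E_def L2_inner_def using nonneg_p by (rule integral_nonneg_AE)
  have H0: "0 \<le> H"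
    unfolding H using nonneg_w by (rule integral_nonneg_AE)

  \<comment> \<open>The factor 4 is the square of the 2 in the pointwise Cauchy-Schwarz bound for
    the symmetrized form, since \<eta> is the symmetrized matrix applied to
    \<open>w\<close>.\<close>
  have "\<bar>L2_inner \<Omega> \<eta> p\<bar> \<le> sqrt (LINT x|lebesgue_on \<Omega>. 4 * ((A x *v w x) \<bullet> w x)) * sqrt E"
    unfolding E_def L2_inner_def
  proof (rule abs_integral_le_sqrt_mult_sqrt)
    show "AE x in lebesgue_on \<Omega>. \<bar>\<eta> x \<bullet> p x\<bar> \<le> sqrt (4 * ((A x *v w x) \<bullet> w x)) * sqrt ((A x *v p x) \<bullet> p x)"
      using w nonneg
    proof eventually_elim
      case (elim x)
      then show ?case
        using abs_inner_symmetrization_le[of "A x" "w x" "p x"] by (simp add: real_sqrt_mult)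
    qed
    show "AE x in lebesgue_on \<Omega>. 0 \<le> 4 * ((A x *v w x) \<bullet> w x)"
      using nonneg_w by simp
  qed (intro integrable_mult_right L2_integrable_inner L2 AL2 \<eta>L2 wL2 AwL2 nonneg_p)+
  also have "(LINT x|lebesgue_on \<Omega>. 4 * ((A x *v w x) \<bullet> w x)) = 4 * H"
    unfolding H by simp
  finally have flux: "\<bar>L2_inner \<Omega> \<eta> p\<bar> \<le> 2 * sqrt H * sqrt E"
    by (simp add: real_sqrt_mult)

  \<comment> \<open>Integrated coercivity bounds the gradient norm by
    \<open>sqrt E / sqrt c\<close>; with Friedrichs this controls \<open>e\<close> in the residual
    term.\<close>
  have "c * (L2_norm \<Omega> p)\<^sup>2 = (LINT x|lebesgue_on \<Omega>. c * (norm (p x))\<^sup>2)"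
    by (simp add: L2_norm_power2)
  also have "\<dots> \<le> E"
    unfolding E_def L2_inner_def
  proof (rule integral_mono_AE)
    show "AE x in lebesgue_on \<Omega>. c * (norm (p x))\<^sup>2 \<le> (A x *v p x) \<bullet> p x"
      using coer by eventually_elim simp
  qed (intro integrable_mult_right L2_integrable_norm_power2 L2_integrable_inner L2 AL2)+
  finally have "sqrt (c * (L2_norm \<Omega> p)\<^sup>2) \<le> sqrt E"
    by simp
  then have p_le: "L2_norm \<Omega> p \<le> sqrt E / sqrt c"
    using \<open>c > 0\<close> by (simp add: real_sqrt_mult L2_norm_nonneg field_simps)
  have "L2_norm \<Omega> e \<le> C\<^sub>F * L2_norm \<Omega> p"
    using assms(9) e by (simp add: p_def)
  also have "\<dots> \<le> C\<^sub>F * (sqrt E / sqrt c)"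
    using p_le CF by (rule mult_left_mono)
  finally have e_le: "L2_norm \<Omega> e \<le> C\<^sub>F * (sqrt E / sqrt c)" .
  have "\<bar>L2_inner \<Omega> (\<lambda>x. weak_div \<Omega> y x + f x) e\<bar> \<le> D * L2_norm \<Omega> e"
    unfolding D_def using divL2 L2(6) by (rule abs_L2_inner_le)
  also have "\<dots> \<le> D * (C\<^sub>F * (sqrt E / sqrt c))"
    using e_le by (rule mult_left_mono) (simp add: D_def L2_norm_nonneg)
  finally have residual: "\<bar>L2_inner \<Omega> (\<lambda>x. weak_div \<Omega> y x + f x) e\<bar> \<le> (C\<^sub>F / sqrt c * D) * sqrt E"
    by (simp add: mult_ac)

  \<comment> \<open>The error identity: \<open>A \<nabla>u\<close> is eliminated by the equation
    tested with \<open>e\<close>, and \<open>A \<nabla>v\<close> is written as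
    \<open>y - \<eta>\<close>, so that integration by parts yields the divergence residual.\<close>
  have "E = L2_inner \<Omega> (\<lambda>x. A x *v weak_grad \<Omega> u x - A x *v weak_grad \<Omega> v x) p"
    unfolding E_def
  proof (rule L2_inner_cong_AE)
    show "AE x in lebesgue_on \<Omega>. A x *v p x = A x *v weak_grad \<Omega> u x - A x *v weak_grad \<Omega> v x"
      using p_diff by eventually_elim (simp add: matrix_vector_mult_diff_distrib)
  qed (use L2 AL2 in \<open>auto intro: L2_measurable L2_diff\<close>)
  also have "\<dots> = L2_inner \<Omega> f e - L2_inner \<Omega> (\<lambda>x. A x *v weak_grad \<Omega> v x) p"
    unfolding L2_inner_diff_left[OF AL2(1,2) L2(5)] using assms(11) e by (simp add: p_def)
  also have "L2_inner \<Omega> (\<lambda>x. A x *v weak_grad \<Omega> v x) p = L2_inner \<Omega> y p - L2_inner \<Omega> \<eta> p"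
    unfolding \<eta>_def[abs_def] by (simp add: L2_inner_diff_left[OF L2(1) AL2(2) L2(5)])
  also have "L2_inner \<Omega> y p = - L2_inner \<Omega> (weak_div \<Omega> y) e"
    unfolding p_def using \<Omega>(1) y e by (rule H01_integration_by_parts)
  finally have "E = L2_inner \<Omega> (\<lambda>x. weak_div \<Omega> y x + f x) e + L2_inner \<Omega> \<eta> p"
    by (simp add: L2_inner_add_left[OF L2(2,7,6)])
  with flux residual have "E \<le> (2 * sqrt H + C\<^sub>F / sqrt c * D) * sqrt E"
    by (simp add: distrib_right)
  then have "sqrt E * sqrt E \<le> (2 * sqrt H + C\<^sub>F / sqrt c * D) * sqrt E"
    using E0 by simp
  \<comment> \<open>This covers \<open>E = 0\<close>, where the factor \<open>sqrt E\<close> cannot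
    be cancelled.\<close>
  moreover have "0 \<le> 2 * sqrt H + C\<^sub>F / sqrt c * D"
    using H0 CF \<open>c > 0\<close> by (simp add: D_def L2_norm_nonneg)
  ultimately have "sqrt E \<le> 2 * sqrt H + C\<^sub>F / sqrt c * D"
    using E0 by (cases "E = 0") (auto intro: mult_right_le_imp_le[of _ "sqrt E"] simp del: real_sqrt_mult_self)
  then show "sqrt (L2_inner \<Omega> (\<lambda>x. A x *v weak_grad \<Omega> (\<lambda>x. u x - v x) x) (weak_grad \<Omega> (\<lambda>x. u x - v x)))
    \<le> 2 * sqrt (L2_inner \<Omega>
          (\<lambda>x. matrix_inv (A x) *v (B x *v (y x - A x *v weak_grad \<Omega> v x)))
          (\<lambda>x. B x *v (y x - A x *v weak_grad \<Omega> v x)))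
      + C\<^sub>F / sqrt c * L2_norm \<Omega> (\<lambda>x. weak_div \<Omega> y x + f x)"
    unfolding E_def H_def D_def p_def e_def[abs_def] w_def[abs_def] z_def[abs_def] \<eta>_def[abs_def] .
qed

end
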